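(* Let $n,d\ge 1$ and let $\mathrm{PH}$ denote either $\mathrm{PH}^{\check{\mathrm C}}$ or $\mathrm{PH}^{\mathrm{VR}}$ on $\mathrm{PC}_{n,d}$. For generic $P\in\mathrm{PC}_{n,d}$ (i.e. there is a proper algebraic subset $A\subset\mathbb{R}^{nd}$ such that the following holds for all $P\in\mathrm{PC}_{n,d}\setminus A$): if there are exactly $k$ distinct bounded interval endpoints in the barcodes in $D=\mathrm{PH}(P)$, then $$\dim \mathrm{PH}^{-1}(D)\ \ge\ nd-k+1 .$$
   Context: Fix a field $\mathbb{F}$; $H_i$ denotes homology in degree $i$ with coefficients in $\mathbb{F}$. $\mathrm{PC}_{n,d}=\{(p_1,\dots,p_n)\in\mathbb{R}^{nd}: p_i\in\mathbb{R}^d,\ p_i\ne p_j \text{ for } i\neq j\}$; its elements are called point clouds. Write $[n]=\{1,\dots,n\}$ and $\|\cdot\|$ for the Euclidean norm. A barcode is a multiset of nonempty intervals in $\mathbb{R}$; a full barcode is a sequence $D=(D_i)_{i\ge0}$ of barcodes. For a filtration $\mathcal X=\{X_t\}_{t\in\mathbb{R}}$ (with $X_s\subseteq X_t$ for $s\le t$) whose persistence modules $\{H_i(X_t)\}_{t}$ are tame (pointwise finite dimensional with finitely many critical values), the degree-$i$ persistent homology is the unique (finite) multiset $D_i$ of nonempty intervals with $\{H_i(X_t)\}_t\cong\bigoplus_{I\in D_i}\chi_I$, where $\chi_I$ is the interval module of $I$ (equal to $\mathbb{F}$ with identity maps on $I$ and $0$ elsewhere). The persistent homology of $\mathcal X$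 is the full barcode $D=(D_i)_{i\ge 0}$. For $P=(p_1,\dots,p_n)\in\mathrm{PC}_{n,d}$: $\mathrm{PH}^{\mathrm{VR}}(P)$ is the persistent homology of the Vietoris–Rips filtration $\mathrm{VR}(P,r)=\{\emptyset\ne\sigma\subseteq[n]:\|p_i-p_j\|\le 2r\ \forall i,j\in\sigma\}$, $r\in\mathbb{R}$ (empty for $r<0$), and $\mathrm{PH}^{\check{\mathrm C}}(P)$ is the persistent homology of the Čech filtration $\{\bigcup_{i=1}^n B_r(p_i)\}_{r\in\mathbb{R}}$ by unions of closed balls of radius $r$ (empty for $r<0$), equivalently of the simplicial filtration $\{\emptyset\ne\sigma\subseteq[n]:\exists q\in\mathbb{R}^d,\ \|p_i-q\|\le r\ \forall i\in\sigma\}$. A bounded endpoint is an endpoint (of an interval in some $D_i$) that is a real number (not $\pm\infty$). $\mathrm{PH}^{-1}(D)=\{Q\in\mathrm{PC}_{n,d}:\mathrm{PH}(Q)=D\}$; this is a semialgebraic set and $\dim$ is its dimension as a semialgebraic set (with $\dim\emptyset=-\infty$). *)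

theory Defs
  imports "HOL-Analysis.Analysis"
begin

section \<open>Point clouds and their filtrations\<close>

text \<open>
  A cloud \<open>P = (p\<^sub>1, \<dots>, p\<^sub>n)\<close> in \<open>\<real>\<^sup>d\<close> is a vector \<open>P :: (real ^ 'd) ^ 'n\<close>, with
  \<open>n = CARD('n)\<close> and \<open>d = CARD('d)\<close>. The index type stands for \<open>[n]\<close>; its linear order is
  used only for the signs in the simplicial boundary.
\<close>

definition point_clouds :: "(real ^ 'd ^ 'n) set" where
  "point_clouds = {P. \<forall>i j. i \<noteq> j \<longrightarrow> P $ i \<noteq> P $ j}"

definition vietoris_rips :: "real ^ 'd ^ 'n \<Rightarrow> real \<Rightarrow> 'n set set" where
  "vietoris_rips P r = {\<sigma>. \<sigma> \<noteq> {} \<and> (\<forall>i\<in>\<sigma>. \<forall>j\<in>\<sigma>. norm (P $ i - P $ j) \<le> 2 * r)}"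

text \<open>The nerve of the closed balls, i.e. the simplicial form of the Cech filtration.\<close>

definition cech :: "real ^ 'd ^ 'n \<Rightarrow> real \<Rightarrow> 'n set set" where
  "cech P r = {\<sigma>. \<sigma> \<noteq> {} \<and> (\<exists>q. \<forall>i\<in>\<sigma>. norm (P $ i - q) \<le> r)}"


section \<open>Simplicial homology with coefficients in a field\<close>

text \<open>
  A complex is a downward closed set of nonempty finite vertex sets; a chain is given by its
  coefficients. Orienting every simplex by the vertex order, a vertex \<open>v\<close> of \<open>insert v \<tau>\<close> has
  position \<open>card {u \<in> \<tau>. u < v}\<close>, so the coefficient of \<open>\<tau>\<close> in \<open>\<partial>c\<close> collects the
  contributions of all \<open>insert v \<tau>\<close>. The value at the empty set is 0, as homology is not reduced.
\<close>

definition simplicial_chains :: "nat \<Rightarrow> 'v set set \<Rightarrow> ('v set \<Rightarrow> 'f::field) set" where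
  "simplicial_chains q K = {c. \<forall>\<sigma>. c \<sigma> \<noteq> 0 \<longrightarrow> \<sigma> \<in> K \<and> card \<sigma> = Suc q}"

definition boundary ::
  "('v::{finite,linorder} set \<Rightarrow> 'f::field) \<Rightarrow> 'v set \<Rightarrow> 'f" where
  "boundary c \<tau> =
     (if \<tau> = {} then 0 else \<Sum>v\<in>-\<tau>. (-1) ^ card {u\<in>\<tau>. u < v} * c (insert v \<tau>))"

definition cycles :: "nat \<Rightarrow> 'v::{finite,linorder} set set \<Rightarrow> ('v set \<Rightarrow> 'f::field) set" where
  "cycles q K = {c \<in> simplicial_chains q K. boundary c = (\<lambda>\<tau>. 0)}"

definition boundaries :: "nat \<Rightarrow> 'v::{finite,linorder} set set \<Rightarrow> ('v set \<Rightarrow> 'f::field) set" where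
  "boundaries q K = boundary ` simplicial_chains (Suc q) K"

definition homologous ::
  "nat \<Rightarrow> 'v::{finite,linorder} set set \<Rightarrow> (('v set \<Rightarrow> 'f::field) \<times> ('v set \<Rightarrow> 'f)) set" where
  "homologous q K =
     {(z, w). z \<in> cycles q K \<and> w \<in> cycles q K \<and> (\<lambda>\<sigma>. z \<sigma> - w \<sigma>) \<in> boundaries q K}"


section \<open>Persistence modules and barcodes\<close>

record ('f, 'a) persistence_module =
  pm_space :: "real \<Rightarrow> 'a set"
  pm_add :: "real \<Rightarrow> 'a \<Rightarrow> 'a \<Rightarrow> 'a"
  pm_scale :: "real \<Rightarrow> 'f \<Rightarrow> 'a \<Rightarrow> 'a"
  pm_map :: "real \<Rightarrow> real \<Rightarrow> 'a \<Rightarrow> 'a"  \<comment> \<open>\<open>pm_map M s t\<close> maps the space at \<open>s\<close> to that at \<open>t \<ge> s\<close>\<close>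

definition pm_iso ::
  "('f, 'a) persistence_module \<Rightarrow> ('f, 'b) persistence_module \<Rightarrow> bool" where
  "pm_iso M N \<longleftrightarrow> (\<exists>f.
     (\<forall>t. bij_betw (f t) (pm_space M t) (pm_space N t)) \<and>
     (\<forall>t. \<forall>x\<in>pm_space M t. \<forall>y\<in>pm_space M t.
        f t (pm_add M t x y) = pm_add N t (f t x) (f t y)) \<and>
     (\<forall>t a. \<forall>x\<in>pm_space M t. f t (pm_scale M t a x) = pm_scale N t a (f t x)) \<and>
     (\<forall>s t. s \<le> t \<longrightarrow> (\<forall>x\<in>pm_space M s. f t (pm_map M s t x) = pm_map N s t (f s x))))"

text \<open>The operations on homology classes are lifted from representatives.\<close>

definition homology_module ::
  "nat \<Rightarrow> (real \<Rightarrow> 'v::{finite,linorder} set set) \<Rightarrow>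
     ('f::field, ('v set \<Rightarrow> 'f) set) persistence_module" where
  "homology_module q X =
     \<lparr>pm_space = (\<lambda>t. cycles q (X t) // homologous q (X t)),
      pm_add = (\<lambda>t U V. \<Union>z\<in>U. \<Union>w\<in>V. homologous q (X t) `` {\<lambda>\<sigma>. z \<sigma> + w \<sigma>}),
      pm_scale = (\<lambda>t a U. \<Union>z\<in>U. homologous q (X t) `` {\<lambda>\<sigma>. a * z \<sigma>}),
      pm_map = (\<lambda>s t U. \<Union>z\<in>U. homologous q (X t) `` {z})\<rparr>"

definition interval_module :: "real set \<Rightarrow> ('f::field, 'f) persistence_module" where
  "interval_module I =
     \<lparr>pm_space = (\<lambda>t. if t \<in> I then UNIV else {0}),
      pm_add = (\<lambda>t x y. x + y),
      pm_scale = (\<lambda>t a x. a * x),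
      pm_map = (\<lambda>s t x. if s \<in> I \<and> t \<in> I then x else 0)\<rparr>"

text \<open>Only used for finite \<open>J\<close>, where the direct sum is the product.\<close>

definition direct_sum_module ::
  "'j set \<Rightarrow> ('j \<Rightarrow> ('f, 'a) persistence_module) \<Rightarrow> ('f, 'j \<Rightarrow> 'a) persistence_module" where
  "direct_sum_module J M =
     \<lparr>pm_space = (\<lambda>t. \<Pi>\<^sub>E j\<in>J. pm_space (M j) t),
      pm_add = (\<lambda>t x y. \<lambda>j\<in>J. pm_add (M j) t (x j) (y j)),
      pm_scale = (\<lambda>t a x. \<lambda>j\<in>J. pm_scale (M j) t a (x j)),
      pm_map = (\<lambda>s t x. \<lambda>j\<in>J. pm_map (M j) s t (x j))\<rparr>"

text \<open>One summand \<open>(I, m)\<close> for each of the \<open>count B I\<close> copies of \<open>I\<close> in \<open>B\<close>.\<close>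

definition barcode_module ::
  "real set multiset \<Rightarrow> ('f::field, real set \<times> nat \<Rightarrow> 'f) persistence_module" where
  "barcode_module B =
     direct_sum_module (SIGMA I:set_mset B. {..<count B I}) (\<lambda>(I, m). interval_module I)"

definition is_barcode :: "real set multiset \<Rightarrow> bool" where
  "is_barcode B \<longleftrightarrow> (\<forall>I\<in>#B. I \<noteq> {} \<and> is_interval I)"

text \<open>
  The full barcode \<open>D\<close> is the persistent homology of \<open>X\<close> over the field \<open>'f\<close>. This is a relation
  (in the manner of \<^const>\<open>has_integral\<close>): the decomposition theorem, by which such a \<open>D\<close> exists
  and is unique for every filtration of complexes on finitely many vertices with finitely many
  critical values, is not built into the definition.
\<close>

definition has_persistent_homology ::
  "'f::field itself \<Rightarrow> (real \<Rightarrow> 'v::{finite,linorder} set set) \<Rightarrow>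
     (nat \<Rightarrow> real set multiset) \<Rightarrow> bool" where
  "has_persistent_homology F X D \<longleftrightarrow>
     (\<forall>i. is_barcode (D i) \<and>
          pm_iso (homology_module i X :: ('f, _) persistence_module) (barcode_module (D i)))"

text \<open>\<open>PH\<^sup>-\<^sup>1(D)\<close>, for the filtration \<open>X P\<close> of a cloud \<open>P\<close>.\<close>

definition ph_fiber ::
  "'f::field itself \<Rightarrow> (real ^ 'd ^ 'n::{finite,linorder} \<Rightarrow> real \<Rightarrow> 'n::{finite,linorder} set set) \<Rightarrow>
     (nat \<Rightarrow> real set multiset) \<Rightarrow> (real ^ 'd ^ 'n::{finite,linorder}) set" where
  "ph_fiber F X D = {Q \<in> point_clouds. has_persistent_homology F (X Q) D}"

definition interval_bounded_endpoints :: "real set \<Rightarrow> real set" where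
  "interval_bounded_endpoints I =
     (if bdd_below I then {Inf I} else {}) \<union> (if bdd_above I then {Sup I} else {})"

definition bounded_endpoints :: "(nat \<Rightarrow> real set multiset) \<Rightarrow> real set" where
  "bounded_endpoints D = (\<Union>i. \<Union>I\<in>set_mset (D i). interval_bounded_endpoints I)"


section \<open>Algebraic and semialgebraic sets\<close>

definition algebraic_set :: "'a::euclidean_space set \<Rightarrow> bool" where
  "algebraic_set A \<longleftrightarrow>
     (\<exists>F. finite F \<and> (\<forall>p\<in>F. real_polynomial_function p) \<and> A = {x. \<forall>p\<in>F. p x = 0})"

inductive semialgebraic :: "'a::euclidean_space set \<Rightarrow> bool" where
  positive: "real_polynomial_function p \<Longrightarrow> semialgebraic {x. p x > 0}"
| complement: "semialgebraic S \<Longrightarrow> semialgebraic (- S)"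
| union: "semialgebraic S \<Longrightarrow> semialgebraic T \<Longrightarrow> semialgebraic (S \<union> T)"

definition semialgebraic_map_on ::
  "'a::euclidean_space set \<Rightarrow> ('a \<Rightarrow> 'b::euclidean_space) \<Rightarrow> bool" where
  "semialgebraic_map_on S f \<longleftrightarrow> semialgebraic ((\<lambda>x. (x, f x)) ` S)"

text \<open>
  The dimension of a semialgebraic set \<open>S\<close> is the largest \<open>m\<close> for which there is an injective
  semialgebraic map from \<open>(0,1)\<^sup>m\<close> to \<open>S\<close> (Basu, Pollack and Roy, Algorithms in Real Algebraic
  Geometry, Section 5.3), and \<open>-\<infinity>\<close> if \<open>S\<close> is empty. Since \<open>m\<close> cannot exceed the dimension of the
  ambient space, \<open>(0,1)\<^sup>m\<close> is realised inside the ambient space, as the open unit cube in the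
  coordinate subspace spanned by a set \<open>B\<close> of \<open>m\<close> basis vectors.
\<close>

definition coordinate_cube :: "'a::euclidean_space set \<Rightarrow> 'a set" where
  "coordinate_cube B =
     {x. (\<forall>b\<in>B. 0 < x \<bullet> b \<and> x \<bullet> b < 1) \<and> (\<forall>b\<in>Basis - B. x \<bullet> b = 0)}"

definition semialgebraic_dim :: "'a::euclidean_space set \<Rightarrow> ereal" where
  "semialgebraic_dim S =
     Sup {ereal (real (card B)) | B. B \<subseteq> Basis \<and>
            (\<exists>f :: 'a \<Rightarrow> 'a. semialgebraic_map_on (coordinate_cube B) f \<and>
               inj_on f (coordinate_cube B) \<and> f ` coordinate_cube B \<subseteq> S)}"

end

theory Submission
  imports Defs
begin

text \<open>
  Both filtrations are sublevel filtrations: a simplex \<open>\<sigma>\<close> enters at a radius \<open>\<rho> P \<sigma>\<close>, half the diameter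
  of its points for Vietoris-Rips and the radius of their minimal enclosing ball for Cech. The radius
  is continuous in \<open>P\<close>, and its square always takes one of finitely many values \<open>N P / D P\<close> with
  polynomials \<open>N, D\<close>: squared half distances, respectively squared circumradii of affinely independent
  subsets, since the centre of the minimal enclosing ball lies in the convex hull of the contact points.

  Call \<open>P\<close> generic if those finitely many polynomials in its coordinates that are relevant and not
  identically zero do not vanish at \<open>P\<close>; a product of nonzero polynomials is nonzero, so this excludes only a
  proper algebraic set. If \<open>P\<close> is generic then two rational functions that agree at \<open>P\<close> agree
  everywhere, so near \<open>P\<close> every squared radius is one fixed rational function and the order of the
  radii, ties included, does not change (\<open>generic_radii_locally_rational\<close>).

  The barcode depends on the radii in a simple way. Bars cannot begin or end while the complex does
  not change, so every bar is \<open>[a, b)\<close> or \<open>[a, \<infinity>)\<close> with endpoints among the radii; and if the radii of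
  \<open>Q\<close> are ordered like those of \<open>P\<close> and the radii that occur as endpoints are the same, then a monotone
  reparametrization of the filtration that respects all bars shows that \<open>Q\<close> has the barcode \<open>D\<close> of \<open>P\<close>
  (\<open>has_persistent_homology_same_order\<close>). One of the \<open>k\<close> endpoints is \<open>0\<close>, where the vertices are
  born and all clouds agree. Hence the fiber contains, near \<open>P\<close>, a common level set of at most \<open>k - 1\<close>
  rational functions.

  A level set of \<open>m\<close> functions may have dimension below \<open>nd - m\<close> over the reals, but not near a generic
  point (\<open>generic_level_set_contains_cube\<close>): there the gradients have locally constant rank, so a
  maximal independent subfamily of size \<open>r \<le> m\<close>, completed by coordinates, is a local
  coordinate system by the inverse function theorem, and the remaining functions are constant where the
  subfamily is. The inverse chart, restricted to a small cube in the \<open>nd - r\<close> free coordinates, is an injective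
  map into the fiber. Its graph is given by polynomial equations and inequalities, so it is
  semialgebraic without any quantifier elimination. The generic rank of the gradients and the rational
  formula for circumradii both come from a fraction-free Gram-Schmidt process
  (\<open>polynomial_cramer_rule\<close>).
\<close>


section \<open>Polynomial functions and generic points\<close>

lemma polynomial_function_scaleR:
  "real_polynomial_function p \<Longrightarrow> polynomial_function f \<Longrightarrow> polynomial_function (\<lambda>x. p x *\<^sub>R f x)"
  by (simp add: polynomial_function_mult real_polynomial_function_eq)

lemma real_polynomial_function_inner:
  fixes f g :: "'a::real_normed_vector \<Rightarrow> 'b::euclidean_space"
  assumes "polynomial_function f" and "polynomial_function g"
  shows "real_polynomial_function (\<lambda>x. f x \<bullet> g x)"
proof -
  have "real_polynomial_function (\<lambda>x. \<Sum>b\<in>Basis. (f x \<bullet> b) * (g x \<bullet> b))"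
    using assms
    by (intro real_polynomial_function_sum real_polynomial_function.intros(4))
       (auto simp: real_polynomial_function_eq)
  then show ?thesis by (subst euclidean_inner)
qed

lemmas polynomial_intros =
  real_polynomial_function.intros(2-4)
  real_polynomial_function_diff real_polynomial_function_divide real_polynomial_function_inner
  polynomial_function_const polynomial_function_id polynomial_function_add polynomial_function_diff
  polynomial_function_scaleR

lemma real_polynomial_function_finite_zeros_on_line:
  fixes p :: "'a::euclidean_space \<Rightarrow> real"
  assumes "real_polynomial_function p" and "p x \<noteq> 0"
  shows "finite {t::real. p (x + t *\<^sub>R v) = 0}"
proof -
  have "polynomial_function (\<lambda>t::real. x + t *\<^sub>R v)"
    by (intro polynomial_function_add polynomial_function_const polynomial_function_bounded_linear
        bounded_linear_scaleR_left)
  then have "real_polynomial_function (p \<circ> (\<lambda>t. x + t *\<^sub>R v))"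
    using assms(1) by (rule real_polynomial_function_compose)
  then obtain a n where an: "(p \<circ> (\<lambda>t. x + t *\<^sub>R v)) = (\<lambda>t. \<Sum>i\<le>n. a i * t ^ i)"
    by (auto simp: real_polynomial_function_iff_sum)
  have "\<exists>k\<le>n. a k \<noteq> 0"
  proof (rule ccontr)
    assume "\<not> ?thesis"
    then have "(\<Sum>i\<le>n. a i * 0 ^ i) = 0" by simp
    with an[THEN fun_cong, of 0] assms(2) show False by simp
  qed
  then have "finite {t. (\<Sum>i\<le>n. a i * t ^ i) = 0}"
    by (simp add: polyfun_finite_roots)
  moreover have "p (x + t *\<^sub>R v) = (\<Sum>i\<le>n. a i * t ^ i)" for t
    using an[THEN fun_cong, of t] by simp
  ultimately show ?thesis by simp
qed

text \<open>
  Induction over the set: on the line through a common nonzero point of \<open>F\<close> and a nonzero point of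
  \<open>f\<close>, each of the polynomials vanishes only finitely often.
\<close>

lemma nonzero_polynomials_common_nonzero:
  fixes F :: "('a::euclidean_space \<Rightarrow> real) set"
  assumes "finite F" and "\<And>f. f \<in> F \<Longrightarrow> real_polynomial_function f \<and> (\<exists>x. f x \<noteq> 0)"
  shows "\<exists>x. \<forall>f\<in>F. f x \<noteq> 0"
  using assms
proof (induction F)
  case (insert f F)
  then obtain x where x: "\<forall>g\<in>F. g x \<noteq> 0" by auto
  from insert.prems obtain y where y: "f y \<noteq> 0" by blast
  have "finite {t. g (x + t *\<^sub>R (y - x)) = 0}" if "g \<in> F" for g
    using insert.prems that x by (intro real_polynomial_function_finite_zeros_on_line) auto
  moreover have "finite {t. f (y + t *\<^sub>R (x - y)) = 0}"
    using insert.prems y by (intro real_polynomial_function_finite_zeros_on_line) auto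
  then have "finite ((\<lambda>t. 1 - t) ` {t. f (y + t *\<^sub>R (x - y)) = 0})" by simp
  moreover have "{t. f (x + t *\<^sub>R (y - x)) = 0} \<subseteq> (\<lambda>t. 1 - t) ` {t. f (y + t *\<^sub>R (x - y)) = 0}"
  proof
    fix t assume "t \<in> {t. f (x + t *\<^sub>R (y - x)) = 0}"
    moreover have "x + t *\<^sub>R (y - x) = y + (1 - t) *\<^sub>R (x - y)" by (simp add: algebra_simps)
    ultimately show "t \<in> (\<lambda>t. 1 - t) ` {t. f (y + t *\<^sub>R (x - y)) = 0}"
      by (intro image_eqI[of _ _ "1 - t"]) auto
  qed
  ultimately have "finite (\<Union>g\<in>insert f F. {t. g (x + t *\<^sub>R (y - x)) = 0})"
    using insert.hyps(1) finite_subset by auto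
  then obtain t where "t \<notin> (\<Union>g\<in>insert f F. {t. g (x + t *\<^sub>R (y - x)) = 0})"
    using ex_new_if_finite[OF infinite_UNIV_char_0] by blast
  then show ?case by (intro exI[of _ "x + t *\<^sub>R (y - x)"]) auto
qed simp

text \<open>
  Polynomials that vanish identically are exempt, so that one need not decide in advance which of the
  polynomials in \<open>F\<close> are nonzero.
\<close>

definition generic_for :: "('a \<Rightarrow> real) set \<Rightarrow> 'a \<Rightarrow> bool" where
  "generic_for F P \<longleftrightarrow> (\<forall>f\<in>F. (\<exists>x. f x \<noteq> 0) \<longrightarrow> f P \<noteq> 0)"

lemma generic_for_outside_algebraic_set:
  fixes F :: "('a::euclidean_space \<Rightarrow> real) set"
  assumes "finite F" and "\<And>f. f \<in> F \<Longrightarrow> real_polynomial_function f"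
  shows "\<exists>A. algebraic_set A \<and> A \<noteq> UNIV \<and> (\<forall>P. P \<notin> A \<longrightarrow> generic_for F P)"
proof -
  define F' where "F' = {f\<in>F. \<exists>x. f x \<noteq> 0}"
  define p where "p = (\<lambda>x. \<Prod>f\<in>F'. f x)"
  have fin: "finite F'" using assms(1) by (simp add: F'_def)
  have "real_polynomial_function p"
    unfolding p_def using assms(2) fin by (intro real_polynomial_function_prod) (auto simp: F'_def)
  then have "algebraic_set {x. p x = 0}"
    unfolding algebraic_set_def by (intro exI[of _ "{p}"]) auto
  moreover obtain x where "\<forall>f\<in>F'. f x \<noteq> 0"
    using nonzero_polynomials_common_nonzero[OF fin] assms(2) by (auto simp: F'_def)
  then have "p x \<noteq> 0" using fin by (simp add: p_def)
  moreover have "generic_for F P" if "p P \<noteq> 0" for P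
    using that fin by (auto simp: p_def generic_for_def F'_def)
  ultimately show ?thesis by (intro exI[of _ "{x. p x = 0}"]) auto
qed

lemma real_polynomial_function_gradient:
  fixes p :: "'a::euclidean_space \<Rightarrow> real"
  assumes "real_polynomial_function p"
  shows "\<exists>G. polynomial_function G \<and> (\<forall>x. (p has_derivative (\<lambda>v. G x \<bullet> v)) (at x))"
  using assms
proof induction
  case (linear f)
  have "f v = (\<Sum>b\<in>Basis. f b *\<^sub>R b) \<bullet> v" for v
  proof -
    have "f v = f (\<Sum>b\<in>Basis. (v \<bullet> b) *\<^sub>R b)" by (simp add: euclidean_representation)
    also have "\<dots> = (\<Sum>b\<in>Basis. (v \<bullet> b) * f b)"
      using linear by (simp add: linear_sum bounded_linear.linear linear_scale)
    finally show ?thesis by (simp add: inner_sum_left inner_commute[of v] mult.commute)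
  qed
  then have gradient: "(\<lambda>v. (\<Sum>b\<in>Basis. f b *\<^sub>R b) \<bullet> v) = f" by (intro ext) (rule sym)
  have "(f has_derivative (\<lambda>v. (\<Sum>b\<in>Basis. f b *\<^sub>R b) \<bullet> v)) (at x)" for x
    unfolding gradient by (rule bounded_linear_imp_has_derivative[OF linear])
  then show ?case by (intro exI[of _ "\<lambda>_. \<Sum>b\<in>Basis. f b *\<^sub>R b"]) simp
next
  case (const c)
  show ?case by (intro exI[of _ "\<lambda>_. 0"]) auto
next
  case (add f g)
  then obtain F G where "polynomial_function F" "\<forall>x. (f has_derivative (\<lambda>v. F x \<bullet> v)) (at x)"
    "polynomial_function G" "\<forall>x. (g has_derivative (\<lambda>v. G x \<bullet> v)) (at x)" by blast
  then show ?case
    by (intro exI[of _ "\<lambda>x. F x + G x"]) (auto simp: inner_add_left intro!: derivative_eq_intros)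
next
  case (mult f g)
  then obtain F G where "polynomial_function F" "\<forall>x. (f has_derivative (\<lambda>v. F x \<bullet> v)) (at x)"
    "polynomial_function G" "\<forall>x. (g has_derivative (\<lambda>v. G x \<bullet> v)) (at x)" by blast
  with mult.hyps show ?case
    by (intro exI[of _ "\<lambda>x. g x *\<^sub>R F x + f x *\<^sub>R G x"])
       (auto simp: inner_add_left algebra_simps intro!: derivative_eq_intros polynomial_intros)
qed

abbreviation independent_family :: "('i \<Rightarrow> 'b::real_vector) \<Rightarrow> 'i set \<Rightarrow> bool" where
  "independent_family v J \<equiv> inj_on v J \<and> independent (v ` J)"

lemma independent_family_insert:
  assumes "i \<notin> J"
  shows "independent_family v (insert i J) \<longleftrightarrow> independent_family v J \<and> v i \<notin> span (v ` J)"
proof (cases "v i \<in> v ` J")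
  case True
  then show ?thesis using assms by (auto simp: span_base)
next
  case False
  then show ?thesis using assms by (auto simp: independent_insert)
qed

text \<open>
  A linear system \<open>v\<^sub>j \<bullet> x = b\<^sub>j\<close> whose data depend polynomially on a parameter has a unique solution in
  the span of the \<open>v\<^sub>j\<close> where these are independent, and it is rational in the parameter:
  \<open>x = W / p\<close>. Moreover \<open>p \<noteq> 0\<close> expresses independence, so that independence is a generic property.
  Instead of determinants, the induction uses a fraction-free Gram-Schmidt step: \<open>R\<close> is \<open>p\<close> times the
  component of the new vector orthogonal to the old ones, and it vanishes iff the new vector
  depends on them.
\<close>

lemma polynomial_cramer_rule:
  fixes V :: "'i \<Rightarrow> 'a::euclidean_space \<Rightarrow> 'b::euclidean_space"
  assumes "finite J" and "\<forall>j\<in>J. polynomial_function (V j)"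
  shows "\<exists>p. real_polynomial_function p \<and> (\<forall>Q. p Q \<noteq> 0 \<longleftrightarrow> independent_family (\<lambda>j. V j Q) J) \<and>
    (\<forall>b. (\<forall>j\<in>J. real_polynomial_function (b j)) \<longrightarrow>
      (\<exists>W. polynomial_function W \<and> (\<forall>Q. p Q \<noteq> 0 \<longrightarrow>
         W Q \<in> span ((\<lambda>j. V j Q) ` J) \<and> (\<forall>j\<in>J. V j Q \<bullet> W Q = p Q * b j Q))))"
  using assms
proof (induction J)
  case empty
  show ?case
    by (intro exI[of _ "\<lambda>_. 1"]) (auto intro!: exI[of _ "\<lambda>_. 0"] simp: independent_empty)
next
  case (insert i J)
  define S where "S Q = span ((\<lambda>j. V j Q) ` J)" for Q
  have "\<exists>p. real_polynomial_function p \<and> (\<forall>Q. p Q \<noteq> 0 \<longleftrightarrow> independent_family (\<lambda>j. V j Q) J) \<and>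
    (\<forall>b. (\<forall>j\<in>J. real_polynomial_function (b j)) \<longrightarrow>
      (\<exists>W. polynomial_function W \<and> (\<forall>Q. p Q \<noteq> 0 \<longrightarrow>
         W Q \<in> S Q \<and> (\<forall>j\<in>J. V j Q \<bullet> W Q = p Q * b j Q))))"
    unfolding S_def by (rule insert.IH) (simp add: insert.prems)
  then obtain p where p: "real_polynomial_function p"
    and p_iff: "\<And>Q. p Q \<noteq> 0 \<longleftrightarrow> independent_family (\<lambda>j. V j Q) J"
    and solve: "\<And>b. \<forall>j\<in>J. real_polynomial_function (b j) \<Longrightarrow>
      \<exists>W. polynomial_function W \<and> (\<forall>Q. p Q \<noteq> 0 \<longrightarrow>
         W Q \<in> S Q \<and> (\<forall>j\<in>J. V j Q \<bullet> W Q = p Q * b j Q))"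
    by blast
  have Vi: "polynomial_function (V i)" using insert.prems by simp
  have "\<forall>j\<in>J. real_polynomial_function (\<lambda>Q. V j Q \<bullet> V i Q)"
    using insert.prems by (intro ballI polynomial_intros) auto
  from solve[OF this] obtain Z where Z: "polynomial_function Z"
    and Z_span: "\<And>Q. p Q \<noteq> 0 \<Longrightarrow> Z Q \<in> S Q"
    and Z_eq: "\<And>Q j. \<lbrakk>p Q \<noteq> 0; j \<in> J\<rbrakk> \<Longrightarrow> V j Q \<bullet> Z Q = p Q * (V j Q \<bullet> V i Q)"
    by blast
  \<comment> \<open>Where \<open>p \<noteq> 0\<close>, \<open>Z\<close> is \<open>p\<close> times the orthogonal projection of \<open>V i\<close> to the span of the old vectors.\<close>
  define R where "R = (\<lambda>Q. p Q *\<^sub>R V i Q - Z Q)"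
  have R: "polynomial_function R"
    unfolding R_def by (intro polynomial_intros p Vi Z)
  have R_orth: "V j Q \<bullet> R Q = 0" if "p Q \<noteq> 0" "j \<in> J" for Q j
    using Z_eq[OF that] by (simp add: R_def inner_diff_right)
  have R_orth_span: "z \<bullet> R Q = 0" if "p Q \<noteq> 0" "z \<in> S Q" for Q z
    using that(2) unfolding S_def
    by (induction rule: span_induct_alt) (use R_orth that(1) in \<open>auto simp: inner_add_left\<close>)
  have ViR: "p Q * (V i Q \<bullet> R Q) = R Q \<bullet> R Q" if "p Q \<noteq> 0" for Q
    using R_orth_span[OF that Z_span[OF that]]
    by (simp add: R_def inner_diff_left inner_diff_right inner_commute[of "V i Q" "Z Q"] algebra_simps)
  have R_zero_iff: "R Q = 0 \<longleftrightarrow> V i Q \<in> S Q" if "p Q \<noteq> 0" for Q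
  proof
    assume "R Q = 0"
    then have "Z Q = p Q *\<^sub>R V i Q" by (simp add: R_def)
    then have "V i Q = (1 / p Q) *\<^sub>R Z Q" using that by simp
    then show "V i Q \<in> S Q" using Z_span[OF that] by (simp add: S_def span_scale)
  next
    assume "V i Q \<in> S Q"
    then have "R Q \<in> S Q"
      using Z_span[OF that] by (simp add: R_def S_def span_scale span_diff)
    from R_orth_span[OF that this] show "R Q = 0" by simp
  qed
  define p' where "p' = (\<lambda>Q. p Q * (R Q \<bullet> R Q))"
  have p'_poly: "real_polynomial_function p'"
    unfolding p'_def by (intro polynomial_intros p R)
  have p'_iff: "p' Q \<noteq> 0 \<longleftrightarrow> independent_family (\<lambda>j. V j Q) (insert i J)" for Q
    unfolding independent_family_insert[OF insert.hyps(2)] p_iff[symmetric]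
    using R_zero_iff[of Q] by (auto simp: p'_def S_def)
  have p'_solve: "\<exists>W. polynomial_function W \<and> (\<forall>Q. p' Q \<noteq> 0 \<longrightarrow>
         W Q \<in> span ((\<lambda>j. V j Q) ` insert i J) \<and> (\<forall>j\<in>insert i J. V j Q \<bullet> W Q = p' Q * b j Q))"
    if b: "\<forall>j\<in>insert i J. real_polynomial_function (b j)" for b
  proof -
    obtain W where W: "polynomial_function W"
      and W_span: "\<And>Q. p Q \<noteq> 0 \<Longrightarrow> W Q \<in> S Q"
      and W_eq: "\<And>Q j. \<lbrakk>p Q \<noteq> 0; j \<in> J\<rbrakk> \<Longrightarrow> V j Q \<bullet> W Q = p Q * b j Q"
      using solve[of b] b by blast
    \<comment> \<open>\<open>R\<close> is orthogonal to the old vectors, so adding a multiple of it only affects the equation for \<open>i\<close>.\<close>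
    define W' where
      "W' = (\<lambda>Q. (R Q \<bullet> R Q) *\<^sub>R W Q + (p Q * p Q * b i Q - p Q * (V i Q \<bullet> W Q)) *\<^sub>R R Q)"
    have W'_poly: "polynomial_function W'"
      unfolding W'_def by (intro polynomial_intros p R W Vi) (use b in blast)
    have W'_span: "W' Q \<in> span ((\<lambda>j. V j Q) ` insert i J)" if "p' Q \<noteq> 0" for Q
    proof -
      have nz: "p Q \<noteq> 0" using that by (auto simp: p'_def)
      have sub: "S Q \<subseteq> span ((\<lambda>j. V j Q) ` insert i J)" unfolding S_def by (intro span_mono) auto
      have "V i Q \<in> span ((\<lambda>j. V j Q) ` insert i J)" by (intro span_base) auto
      then show ?thesis
        unfolding W'_def R_def using sub W_span[OF nz] Z_span[OF nz]
        by (intro span_add span_scale span_diff) auto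
    qed
    have W'_eq: "V j Q \<bullet> W' Q = p' Q * b j Q" if "p' Q \<noteq> 0" "j \<in> insert i J" for Q j
    proof -
      have nz: "p Q \<noteq> 0" using that by (auto simp: p'_def)
      show ?thesis
      proof (cases "j = i")
        case True
        have "V i Q \<bullet> W' Q = (R Q \<bullet> R Q) * (V i Q \<bullet> W Q) +
            (p Q * b i Q - V i Q \<bullet> W Q) * (p Q * (V i Q \<bullet> R Q))"
          by (simp add: W'_def inner_add_right algebra_simps)
        with ViR[OF nz] True show ?thesis by (simp add: p'_def algebra_simps)
      next
        case False
        with that have "j \<in> J" by simp
        then have "V j Q \<bullet> R Q = 0" and "V j Q \<bullet> W Q = p Q * b j Q"
          using R_orth[OF nz] W_eq[OF nz] by auto
        then show ?thesis by (simp add: W'_def inner_add_right p'_def)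
      qed
    qed
    show ?thesis by (intro exI[of _ W'] conjI allI impI ballI W'_poly W'_span W'_eq)
  qed
  show ?case by (intro exI[of _ p'] conjI allI impI p'_poly p'_iff p'_solve)
qed


section \<open>Semialgebraic sets\<close>

lemma semialgebraic_Int: "semialgebraic S \<Longrightarrow> semialgebraic T \<Longrightarrow> semialgebraic (S \<inter> T)"
  using semialgebraic.complement[OF semialgebraic.union[OF semialgebraic.complement semialgebraic.complement]]
  by (metis Compl_Un double_complement)

lemma semialgebraic_equation:
  assumes "real_polynomial_function p" shows "semialgebraic {x. p x = 0}"
proof -
  have "{x. p x = 0} = - {x. p x > 0} \<inter> - {x. - p x > 0}" by auto
  then show ?thesis
    using assms by (simp only:) (intro semialgebraic_Int semialgebraic.complement semialgebraic.positive
        real_polynomial_function_minus)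
qed

lemma semialgebraic_UNIV: "semialgebraic UNIV"
  using semialgebraic_equation[of "\<lambda>_. 0"] by auto

lemma semialgebraic_INT:
  assumes "finite I" and "\<And>i. i \<in> I \<Longrightarrow> semialgebraic (S i)"
  shows "semialgebraic {x. \<forall>i\<in>I. x \<in> S i}"
  using assms
proof (induction I)
  case (insert i I)
  have "{x. \<forall>j\<in>insert i I. x \<in> S j} = S i \<inter> {x. \<forall>j\<in>I. x \<in> S j}" by auto
  with insert show ?case by (auto intro: semialgebraic_Int)
qed (simp add: semialgebraic_UNIV)

lemma semialgebraic_coordinate_cube: 
  fixes B :: "'a::euclidean_space set" and \<pi> :: "'b::euclidean_space \<Rightarrow> 'a"
  assumes "finite B" and "bounded_linear \<pi>"
  shows "semialgebraic {z. \<pi> z \<in> coordinate_cube B}"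
proof -
  have coord: "real_polynomial_function (\<lambda>z. \<pi> z \<bullet> b)" for b
    using assms(2) by (intro real_polynomial_function.intros(1) bounded_linear_inner_left_comp)
  have "{z. \<pi> z \<in> coordinate_cube B} =
      {z. \<forall>b\<in>B. z \<in> {z. \<pi> z \<bullet> b > 0} \<inter> {z. 1 - \<pi> z \<bullet> b > 0}} \<inter> {z. \<forall>b\<in>Basis - B. z \<in> {z. \<pi> z \<bullet> b = 0}}"
    by (auto simp: coordinate_cube_def)
  moreover have "semialgebraic {z. \<forall>b\<in>B. z \<in> {z. \<pi> z \<bullet> b > 0} \<inter> {z. 1 - \<pi> z \<bullet> b > 0}}"
    using assms(1) coord by (intro semialgebraic_INT semialgebraic_Int semialgebraic.positive
        real_polynomial_function_diff real_polynomial_function.intros(2)) auto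
  moreover have "semialgebraic {z. \<forall>b\<in>Basis - B. z \<in> {z. \<pi> z \<bullet> b = 0}}"
    using coord by (intro semialgebraic_INT semialgebraic_equation) auto
  ultimately show ?thesis using semialgebraic_Int by simp
qed


section \<open>Level sets of rational functions\<close>

text \<open>
  The inverse function theorem for functions \<open>\<phi> b\<close> with gradients \<open>w b\<close>, indexed by the standard basis. It is
  phrased with the components so that some of them can be chosen to be plain coordinates.
\<close>

lemma local_coordinates:
  fixes \<phi> :: "'a::euclidean_space \<Rightarrow> 'a \<Rightarrow> real" and w :: "'a \<Rightarrow> 'a \<Rightarrow> 'a"
  assumes "open U" and "P \<in> U"
    and deriv: "\<And>b x. \<lbrakk>b \<in> Basis; x \<in> U\<rbrakk> \<Longrightarrow> (\<phi> b has_derivative (\<lambda>v. w b x \<bullet> v)) (at x)"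
    and cont: "\<And>b. b \<in> Basis \<Longrightarrow> continuous_on U (w b)"
    and inj: "\<And>v. \<forall>b\<in>Basis. w b P \<bullet> v = 0 \<Longrightarrow> v = 0"
  obtains U' V g where "open U'" "U' \<subseteq> U" "P \<in> U'" "open V" "(\<Sum>b\<in>Basis. \<phi> b P *\<^sub>R b) \<in> V"
    "\<And>x. x \<in> U' \<Longrightarrow> g (\<Sum>b\<in>Basis. \<phi> b x *\<^sub>R b) = x"
    "\<And>y. y \<in> V \<Longrightarrow> g y \<in> U'" "\<And>y b. \<lbrakk>y \<in> V; b \<in> Basis\<rbrakk> \<Longrightarrow> \<phi> b (g y) = y \<bullet> b"
    "\<And>y. y \<in> V \<Longrightarrow> g differentiable (at y)"
proof -
  define F where "F x = (\<Sum>b\<in>Basis. \<phi> b x *\<^sub>R b)" for x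
  define F' where "F' x = Blinfun (\<lambda>v. \<Sum>b\<in>Basis. (w b x \<bullet> v) *\<^sub>R b)" for x
  have F'_apply: "blinfun_apply (F' x) = (\<lambda>v. \<Sum>b\<in>Basis. (w b x \<bullet> v) *\<^sub>R b)" for x
    unfolding F'_def
    by (intro bounded_linear_Blinfun_apply bounded_linear_sum bounded_linear_scaleR_const
        bounded_linear_inner_right)
  have F_deriv: "(F has_derivative F' x) (at x)" if "x \<in> U" for x
    unfolding F_def F'_apply using deriv that by (auto intro!: derivative_eq_intros)
  have F'_cont: "continuous_on U F'"
    by (rule continuous_on_blinfun_componentwise) (auto simp: F'_apply intro!: continuous_intros cont)
  have lin: "linear (F' P)" by (rule bounded_linear.linear) (rule blinfun.bounded_linear_right)
  have "inj (F' P)"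
    unfolding linear_injective_0[OF lin]
  proof (intro allI impI)
    fix v assume "F' P v = 0"
    then have "w b P \<bullet> v = 0" if "b \<in> Basis" for b
      using that inner_sum_left_Basis[OF that, of "\<lambda>b. w b P \<bullet> v"] by (simp add: F'_apply)
    with inj show "v = 0" by blast
  qed
  from linear_injective_left_inverse[OF lin this]
  obtain L where L: "linear L" "L \<circ> F' P = id" by blast
  have invF: "Blinfun L o\<^sub>L F' P = id_blinfun"
    using L(2) by (intro blinfun_eqI)
      (simp add: bounded_linear_Blinfun_apply linear_conv_bounded_linear[symmetric] L(1) fun_eq_iff)
  have F_inner: "F x \<bullet> b = \<phi> b x" if "b \<in> Basis" for x b
    using that by (simp add: F_def)
  show thesis
  proof (rule inverse_function_theorem[OF \<open>open U\<close> F_deriv F'_cont \<open>P \<in> U\<close> invF])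
    fix U' V :: "'a set" and g :: "'a \<Rightarrow> 'a" and g' :: "'a \<Rightarrow> 'a \<Rightarrow> 'a"
    assume U': "open U'" "U' \<subseteq> U" "P \<in> U'" and V: "open V" "F P \<in> V"
      and hom: "homeomorphism U' V F g" and g': "\<And>y. y \<in> V \<Longrightarrow> (g has_derivative g' y) (at y)"
    show thesis
    proof (rule that[OF U' V(1)])
    show "(\<Sum>b\<in>Basis. \<phi> b P *\<^sub>R b) \<in> V" using V(2) by (simp add: F_def)
    show "g (\<Sum>b\<in>Basis. \<phi> b x *\<^sub>R b) = x" if "x \<in> U'" for x
      using homeomorphism_apply1[OF hom that] by (simp add: F_def)
    show "g y \<in> U'" if "y \<in> V" for y using hom that by (auto simp: homeomorphism_def)
    show "\<phi> b (g y) = y \<bullet> b" if "y \<in> V" "b \<in> Basis" for y b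
      using homeomorphism_apply2[OF hom that(1)] F_inner[OF that(2), of "g y"] by simp
    show "g differentiable at y" if "y \<in> V" for y using g'[OF that] by (auto simp: differentiable_def)
    qed
  qed
qed

lemma inner_span_eq_zero:
  fixes v :: "'a::real_inner"
  assumes "\<And>x. x \<in> S \<Longrightarrow> x \<bullet> v = 0" and "y \<in> span S"
  shows "y \<bullet> v = 0"
  using assms(2) by (induction rule: span_induct_alt) (auto simp: inner_add_left assms(1))

lemma complete_to_basis_by_coordinates:
  fixes S :: "'a::euclidean_space set"
  assumes "independent S"
  obtains B where "B \<subseteq> Basis" "card B + card S = DIM('a)" "span (S \<union> B) = UNIV"
proof -
  from maximal_independent_subset_extend[OF Un_upper1[of S Basis] assms] obtain T where T: "S \<subseteq> T"
    "T \<subseteq> S \<union> Basis" "independent T" "S \<union> Basis \<subseteq> span T" by blast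
  have "span Basis \<subseteq> span T" using T(4) by (intro span_minimal) auto
  then have span_T: "span T = UNIV" by auto
  then have card_T: "card T = DIM('a)" using basis_card_eq_dim[of T UNIV] T(3) by (simp add: dim_UNIV)
  have "finite T" using T(3) by (rule independent_imp_finite)
  show thesis
  proof (rule that[of "T - S"])
    show "T - S \<subseteq> Basis" using T(2) by blast
    show "card (T - S) + card S = DIM('a)"
      using T(1) \<open>finite T\<close> card_T card_mono[of T S] by (simp add: card_Diff_subset finite_subset)
    have "S \<union> (T - S) = T" using T(1) by blast
    then show "span (S \<union> (T - S)) = UNIV" using span_T by simp
  qed
qed

abbreviation ratio :: "('a \<Rightarrow> real) \<times> ('a \<Rightarrow> real) \<Rightarrow> 'a \<Rightarrow> real" where
  "ratio h x \<equiv> fst h x / snd h x"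

text \<open>
  A witness for \<open>semialgebraic_dim S \<ge> m\<close>, where the cube may have more than \<open>m\<close> dimensions.
\<close>

definition contains_cube :: "'a::euclidean_space set \<Rightarrow> nat \<Rightarrow> bool" where
  "contains_cube S m \<longleftrightarrow> (\<exists>B. \<exists>f :: 'a \<Rightarrow> 'a. B \<subseteq> Basis \<and> m \<le> card B \<and> semialgebraic_map_on (coordinate_cube B) f \<and>
     inj_on f (coordinate_cube B) \<and> f ` coordinate_cube B \<subseteq> S)"

lemma constant_along_segment:
  fixes g :: "'a::euclidean_space \<Rightarrow> 'a" and \<Phi> :: "'a \<Rightarrow> real"
  assumes deriv: "\<And>t. \<lbrakk>0 \<le> t; t \<le> 1\<rbrakk> \<Longrightarrow> \<exists>D. (f has_derivative D) (at (y + t *\<^sub>R z)) \<and> D z = (0::real)"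
  shows "f (y + z) = f y"
proof -
  have "(\<lambda>t. f (y + t *\<^sub>R z)) 1 = (\<lambda>t. f (y + t *\<^sub>R z)) 0"
  proof (rule has_derivative_zero_unique[where s = "{0..1}" and f = "\<lambda>t. f (y + t *\<^sub>R z)"])
    fix t :: real assume "t \<in> {0..1}"
    with deriv obtain D where D: "(f has_derivative D) (at (y + t *\<^sub>R z))" "D z = 0" by force
    have "((\<lambda>t. y + t *\<^sub>R z) has_derivative (\<lambda>s. s *\<^sub>R z)) (at t)"
      by (auto intro!: derivative_eq_intros)
    from has_derivative_compose[OF this D(1)]
    have "((\<lambda>t. f (y + t *\<^sub>R z)) has_derivative (\<lambda>s. D (s *\<^sub>R z))) (at t)" .
    moreover have "D (s *\<^sub>R z) = 0" for s
      using D by (simp add: linear_cmul[OF has_derivative_linear[OF D(1)]])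
    ultimately show "((\<lambda>t. f (y + t *\<^sub>R z)) has_derivative (\<lambda>h. 0)) (at t within {0..1})"
      by (simp add: has_derivative_at_withinI)
  qed auto
  then show ?thesis by simp
qed

text \<open>
  The constant rank theorem, in the form needed for a dimension bound: near \<open>P\<close> the gradients of all the
  functions in \<open>J\<close> lie in the span of those in \<open>K\<close>, which are independent at \<open>P\<close>. The gradient of \<open>h\<close> is
  \<open>c h *\<^sub>R G h\<close>; the nonzero factor \<open>c h\<close> is separated from \<open>G h\<close> because \<open>G h\<close> can then be
  polynomial.
\<close>

lemma constant_rank_level_set_contains_cube:
  fixes J K :: "(('a::euclidean_space \<Rightarrow> real) \<times> ('a \<Rightarrow> real)) set" and G :: "_ \<Rightarrow> 'a \<Rightarrow> 'a"
    and c :: "_ \<Rightarrow> 'a \<Rightarrow> real"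
  assumes "finite J" and "K \<subseteq> J" and "open N" and "P \<in> N"
    and poly: "\<And>h. h \<in> J \<Longrightarrow> real_polynomial_function (fst h) \<and> real_polynomial_function (snd h)"
    and nz: "\<And>h Q. h \<in> J \<Longrightarrow> Q \<in> N \<Longrightarrow> snd h Q \<noteq> 0"
    and cont: "\<And>h. h \<in> J \<Longrightarrow> continuous_on N (G h)"
    and c_nz: "\<And>h Q. h \<in> J \<Longrightarrow> Q \<in> N \<Longrightarrow> c h Q \<noteq> 0"
    and c_cont: "\<And>h. h \<in> J \<Longrightarrow> continuous_on N (c h)"
    and deriv: "\<And>h Q. h \<in> J \<Longrightarrow> Q \<in> N \<Longrightarrow> (ratio h has_derivative (\<lambda>v. (c h Q *\<^sub>R G h Q) \<bullet> v)) (at Q)"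
    and indep: "independent_family (\<lambda>h. G h P) K"
    and dep: "\<And>h Q. h \<in> J \<Longrightarrow> Q \<in> N \<Longrightarrow> G h Q \<in> span ((\<lambda>h. G h Q) ` K)"
  shows "contains_cube {Q \<in> N. \<forall>h\<in>J. ratio h Q = ratio h P} (DIM('a) - card K)"
proof -
  define S where "S = (\<lambda>h. G h P) ` K"
  have "finite K" using assms(1,2) finite_subset by blast
  have "independent S" using indep by (simp add: S_def)
  have card_S: "card S = card K" using indep by (simp add: S_def card_image)
  obtain B where B: "B \<subseteq> Basis" "card B + card S = DIM('a)" "span (S \<union> B) = UNIV"
    using complete_to_basis_by_coordinates[OF \<open>independent S\<close>] .
  have "card (Basis - B) = card K"
    using B(1,2) card_S by (simp add: card_Diff_subset finite_subset[OF B(1)])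
  then obtain \<gamma> where \<gamma>: "bij_betw \<gamma> (Basis - B) K"
    using finite_same_card_bij[OF _ \<open>finite K\<close>, of "Basis - B"] by auto
  have \<gamma>_K: "\<gamma> b \<in> K" and \<gamma>_J: "\<gamma> b \<in> J" if "b \<in> Basis" "b \<notin> B" for b
    using bij_betwE[OF \<gamma>] that \<open>K \<subseteq> J\<close> by auto
  define \<phi> where "\<phi> b = (if b \<in> B then (\<lambda>Q. Q \<bullet> b) else ratio (\<gamma> b))" for b
  define w where "w b = (if b \<in> B then (\<lambda>_. b) else (\<lambda>x. c (\<gamma> b) x *\<^sub>R G (\<gamma> b) x))" for b
  obtain U' V g where U': "open U'" "U' \<subseteq> N" "P \<in> U'"
    and V: "open V" "(\<Sum>b\<in>Basis. \<phi> b P *\<^sub>R b) \<in> V"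
    and g_left: "\<And>x. x \<in> U' \<Longrightarrow> g (\<Sum>b\<in>Basis. \<phi> b x *\<^sub>R b) = x"
    and g_mem: "\<And>y. y \<in> V \<Longrightarrow> g y \<in> U'"
    and g_right: "\<And>y b. \<lbrakk>y \<in> V; b \<in> Basis\<rbrakk> \<Longrightarrow> \<phi> b (g y) = y \<bullet> b"
    and g_diff: "\<And>y. y \<in> V \<Longrightarrow> g differentiable (at y)"
  proof (rule local_coordinates[where \<phi> = \<phi> and w = w, OF \<open>open N\<close> \<open>P \<in> N\<close>])
    show "(\<phi> b has_derivative (\<lambda>v. w b x \<bullet> v)) (at x)" if "b \<in> Basis" "x \<in> N" for b x
      using deriv[OF \<gamma>_J[OF that(1)] that(2)]
      by (auto simp: \<phi>_def w_def inner_commute intro!: derivative_eq_intros)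
    show "continuous_on N (w b)" if "b \<in> Basis" for b
      using cont[OF \<gamma>_J[OF that]] c_cont[OF \<gamma>_J[OF that]] by (auto simp: w_def intro!: continuous_intros)
    show "v = 0" if v: "\<forall>b\<in>Basis. w b P \<bullet> v = 0" for v
    proof -
      have "x \<bullet> v = 0" if x: "x \<in> S \<union> B" for x
      proof (cases "x \<in> B")
        case True
        then show ?thesis using v B(1) by (auto simp: w_def dest!: bspec[of _ _ x])
      next
        case False
        with x obtain h where "h \<in> K" "x = G h P" by (auto simp: S_def)
        with \<gamma> obtain b where "b \<in> Basis - B" "h = \<gamma> b" by (metis bij_betw_imp_surj_on imageE)
        with v have "c h P * (G h P \<bullet> v) = 0" by (auto simp: w_def)
        moreover have "c h P \<noteq> 0" using c_nz \<open>h \<in> K\<close> \<open>K \<subseteq> J\<close> \<open>P \<in> N\<close> by blast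
        ultimately show ?thesis using \<open>x = G h P\<close> by simp
      qed
      then have "v \<bullet> v = 0" by (rule inner_span_eq_zero[of "S \<union> B"]) (simp_all add: B(3))
      then show "v = 0" by simp
    qed
  qed (rule that; assumption)
  define y0 where "y0 = (\<Sum>b\<in>Basis. \<phi> b P *\<^sub>R b)"
  have g_y0: "g y0 = P" using g_left[OF U'(3)] by (simp add: y0_def)
  have "y0 \<in> V" using V(2) by (simp add: y0_def)
  obtain \<delta> where \<delta>: "\<delta> > 0" "ball P \<delta> \<subseteq> U'" using U' by (meson openE)
  obtain \<eta> where \<eta>: "\<eta> > 0" "ball y0 \<eta> \<subseteq> V" "\<And>y. y \<in> ball y0 \<eta> \<Longrightarrow> g y \<in> ball P \<delta>"
  proof -
    obtain \<eta>1 where 1: "\<eta>1 > 0" "ball y0 \<eta>1 \<subseteq> V" using \<open>open V\<close> \<open>y0 \<in> V\<close> by (meson openE)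
    have "isCont g y0" using g_diff[OF \<open>y0 \<in> V\<close>] by (rule differentiable_imp_continuous_within)
    then obtain \<eta>2 where 2: "\<eta>2 > 0" "\<And>y. dist y y0 < \<eta>2 \<Longrightarrow> dist (g y) (g y0) < \<delta>"
      using \<delta>(1) unfolding continuous_at_eps_delta by metis
    show thesis
      using 1 2 by (intro that[of "min \<eta>1 \<eta>2"]) (auto simp: g_y0 dist_commute)
  qed
  \<comment> \<open>Along a direction \<open>z\<close> of free coordinates the functions in \<open>K\<close> do not change, hence no function in \<open>J\<close> does.\<close>
  have level: "ratio h (g (y0 + z)) = ratio h P"
    if "h \<in> J" "norm z < \<eta>" and z: "\<And>b. b \<in> Basis - B \<Longrightarrow> z \<bullet> b = 0" for h z
  proof -
    have "ratio h (g (y0 + z)) = ratio h (g y0)"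
    proof (rule constant_along_segment)
      fix t :: real assume t: "0 \<le> t" "t \<le> 1"
      define y where "y = y0 + t *\<^sub>R z"
      have "norm (t *\<^sub>R z) \<le> norm z" using t by (simp add: mult_left_le_one_le)
      then have "y \<in> ball y0 \<eta>" using \<open>norm z < \<eta>\<close> by (simp add: y_def dist_norm)
      then have "y \<in> V" using \<eta>(2) by blast
      then obtain g' where g': "(g has_derivative g') (at y)"
        using g_diff by (auto simp: differentiable_def)
      have "g y \<in> N" using g_mem[OF \<open>y \<in> V\<close>] U'(2) by blast
      have chain: "((\<lambda>y. ratio i (g y)) has_derivative (\<lambda>v. (c i (g y) *\<^sub>R G i (g y)) \<bullet> g' v)) (at y)" if "i \<in> J" for i
        using has_derivative_compose[OF g' deriv[OF that \<open>g y \<in> N\<close>]] .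
      have "x \<bullet> g' z = 0" if "x \<in> (\<lambda>i. G i (g y)) ` K" for x
      proof -
        from that obtain i where i: "i \<in> K" "x = G i (g y)" by blast
        with \<gamma> obtain b where b: "b \<in> Basis - B" "i = \<gamma> b" by (metis bij_betw_imp_surj_on imageE)
        have "((\<lambda>y. y \<bullet> b) has_derivative (\<lambda>v. (c i (g y) *\<^sub>R G i (g y)) \<bullet> g' v)) (at y)"
        proof (rule has_derivative_transform_within_open[OF chain \<open>open V\<close> \<open>y \<in> V\<close>])
          show "i \<in> J" using i(1) \<open>K \<subseteq> J\<close> by blast
          show "ratio i (g y') = y' \<bullet> b" if "y' \<in> V" for y'
            using g_right[OF that, of b] b by (simp add: \<phi>_def)
        qed
        moreover have "((\<lambda>y. y \<bullet> b) has_derivative (\<lambda>v. v \<bullet> b)) (at y)"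
          by (auto intro!: derivative_eq_intros)
        ultimately have "(\<lambda>v. (c i (g y) *\<^sub>R G i (g y)) \<bullet> g' v) = (\<lambda>v. v \<bullet> b)" by (rule has_derivative_unique)
        then have "(c i (g y) *\<^sub>R G i (g y)) \<bullet> g' z = z \<bullet> b" by (rule fun_cong)
        moreover have "c i (g y) \<noteq> 0" using c_nz i(1) \<open>K \<subseteq> J\<close> \<open>g y \<in> N\<close> by blast
        ultimately show ?thesis using z[OF b(1)] i(2) by simp
      qed
      then have "G h (g y) \<bullet> g' z = 0"
        using dep[OF \<open>h \<in> J\<close> \<open>g y \<in> N\<close>] by (rule inner_span_eq_zero)
      then have "(c h (g y) *\<^sub>R G h (g y)) \<bullet> g' z = 0" by simp
      with chain[OF \<open>h \<in> J\<close>]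
      show "\<exists>D. ((\<lambda>y. ratio h (g y)) has_derivative D) (at (y0 + t *\<^sub>R z)) \<and> D z = 0"
        unfolding y_def by blast
    qed
    then show ?thesis by (simp add: g_y0)
  qed
  \<comment> \<open>The unit cube, scaled by \<open>\<epsilon>\<close>, fits into the ball of radius \<open>\<eta>\<close>.\<close>
  define \<epsilon> where "\<epsilon> = \<eta> / (real DIM('a) + 1)"
  have "\<epsilon> > 0" using \<eta>(1) by (simp add: \<epsilon>_def)
  have small: "norm (\<epsilon> *\<^sub>R x) < \<eta>" if "x \<in> coordinate_cube B" for x
  proof -
    have "\<bar>x \<bullet> b\<bar> \<le> 1" if "b \<in> Basis" for b
      using that \<open>x \<in> coordinate_cube B\<close> by (cases "b \<in> B") (auto simp: coordinate_cube_def less_imp_le)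
    then have "(\<Sum>b\<in>Basis. \<bar>x \<bullet> b\<bar>) \<le> (\<Sum>b\<in>(Basis::'a set). 1)" by (rule sum_mono)
    then have "norm x \<le> real DIM('a)" using norm_le_l1[of x] by simp
    then have "\<epsilon> * norm x < \<epsilon> * (real DIM('a) + 1)" using \<open>\<epsilon> > 0\<close> by simp
    then show ?thesis using \<open>\<epsilon> > 0\<close> \<eta>(1) by (simp add: \<epsilon>_def)
  qed
  define f where "f x = g (y0 + \<epsilon> *\<^sub>R x)" for x
  have in_ball: "y0 + \<epsilon> *\<^sub>R x \<in> ball y0 \<eta>" if "x \<in> coordinate_cube B" for x
    using small[OF that] by (simp add: dist_norm)
  have f_\<phi>: "\<phi> b (f x) = y0 \<bullet> b + \<epsilon> * (x \<bullet> b)" if "x \<in> coordinate_cube B" "b \<in> Basis" for x b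
    unfolding f_def using g_right[of "y0 + \<epsilon> *\<^sub>R x" b] in_ball[OF that(1)] \<eta>(2) that(2)
    by (auto simp: inner_add_left)
  have f_ball: "f x \<in> ball P \<delta>" if "x \<in> coordinate_cube B" for x
    unfolding f_def using \<eta>(3) in_ball[OF that] by blast
  have zero_outside: "x \<bullet> b = 0" if "x \<in> coordinate_cube B" "b \<in> Basis - B" for x b
    using that by (auto simp: coordinate_cube_def)
  have "f ` coordinate_cube B \<subseteq> {Q \<in> N. \<forall>h\<in>J. ratio h Q = ratio h P}"
  proof clarify
    fix x assume x: "x \<in> coordinate_cube B"
    have "f x \<in> N" using f_ball[OF x] \<delta>(2) U'(2) by blast
    moreover have "ratio h (f x) = ratio h P" if "h \<in> J" for h
      unfolding f_def using that small[OF x] zero_outside[OF x] by (intro level) auto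
    ultimately show "f x \<in> N \<and> (\<forall>h\<in>J. ratio h (f x) = ratio h P)" by blast
  qed
  moreover have "inj_on f (coordinate_cube B)"
  proof (rule inj_onI)
    fix x y assume xy: "x \<in> coordinate_cube B" "y \<in> coordinate_cube B" "f x = f y"
    show "x = y"
    proof (rule euclidean_eqI)
      fix b :: 'a assume "b \<in> Basis"
      with f_\<phi>[OF xy(1), of b] f_\<phi>[OF xy(2), of b] xy(3) \<open>\<epsilon> > 0\<close> show "x \<bullet> b = y \<bullet> b" by simp
    qed
  qed
  moreover have "semialgebraic_map_on (coordinate_cube B) f"
  proof -
    \<comment> \<open>After multiplying by denominators, \<open>q b (x, Q) = 0\<close> says that the coordinate \<open>b\<close> of \<open>Q\<close> is that of \<open>f x\<close>.\<close>
    define q where "q b = (\<lambda>z::'a\<times>'a. if b \<in> B then snd z \<bullet> b - (y0 \<bullet> b + \<epsilon> * (fst z \<bullet> b))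
        else fst (\<gamma> b) (snd z) - (y0 \<bullet> b) * snd (\<gamma> b) (snd z))" for b
    have q_iff: "q b (x, Q) = 0 \<longleftrightarrow> \<phi> b Q = y0 \<bullet> b + \<epsilon> * (x \<bullet> b)"
      if "b \<in> Basis" "x \<in> coordinate_cube B" "Q \<in> ball P \<delta>" for b x Q
    proof (cases "b \<in> B")
      case True
      then show ?thesis by (simp add: q_def \<phi>_def)
    next
      case False
      have "snd (\<gamma> b) Q \<noteq> 0" using nz[OF \<gamma>_J[OF that(1) False]] that(3) \<delta>(2) U'(2) by blast
      with False zero_outside[OF that(2), of b] that(1) show ?thesis
        by (auto simp: q_def \<phi>_def field_simps)
    qed
    have graph: "(\<lambda>x. (x, f x)) ` coordinate_cube B =
        {z. fst z \<in> coordinate_cube B} \<inter> {z. \<delta>\<^sup>2 - (snd z - P) \<bullet> (snd z - P) > 0} \<inter>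
        {z. \<forall>b\<in>Basis. z \<in> {z. q b z = 0}}"
    proof -
      have ball_iff: "Q \<in> ball P \<delta> \<longleftrightarrow> \<delta>\<^sup>2 - (Q - P) \<bullet> (Q - P) > 0" for Q
      proof -
        have "dist P Q < \<delta> \<longleftrightarrow> (dist P Q)\<^sup>2 < \<delta>\<^sup>2"
          using \<delta>(1) by (metis abs_of_pos power2_less_imp_less power_strict_mono zero_le_dist zero_less_numeral less_imp_le)
        then show ?thesis by (simp add: dist_norm norm_minus_commute dot_square_norm)
      qed
      have f_iff: "Q = f x \<longleftrightarrow> Q \<in> ball P \<delta> \<and> (\<forall>b\<in>Basis. q b (x, Q) = 0)" if x: "x \<in> coordinate_cube B" for x Q
      proof
        assume "Q = f x"
        then show "Q \<in> ball P \<delta> \<and> (\<forall>b\<in>Basis. q b (x, Q) = 0)"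
          using f_ball[OF x] f_\<phi>[OF x] q_iff[OF _ x, of _ Q] by blast
      next
        assume Q: "Q \<in> ball P \<delta> \<and> (\<forall>b\<in>Basis. q b (x, Q) = 0)"
        then have "\<phi> b Q = y0 \<bullet> b + \<epsilon> * (x \<bullet> b)" if "b \<in> Basis" for b
          using q_iff[OF that x, of Q] that by blast
        then have "(\<Sum>b\<in>Basis. \<phi> b Q *\<^sub>R b) = (\<Sum>b\<in>Basis. ((y0 + \<epsilon> *\<^sub>R x) \<bullet> b) *\<^sub>R b)"
          by (intro sum.cong) (auto simp: inner_add_left)
        also have "\<dots> = y0 + \<epsilon> *\<^sub>R x" by (rule euclidean_representation)
        finally show "Q = f x" using g_left[of Q] Q \<delta>(2) by (auto simp: f_def)
      qed
      have key: "snd z = f (fst z) \<longleftrightarrow>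
          \<delta>\<^sup>2 - (snd z - P) \<bullet> (snd z - P) > 0 \<and> (\<forall>b\<in>Basis. q b z = 0)"
        if "fst z \<in> coordinate_cube B" for z
        using f_iff[OF that, of "snd z"] ball_iff[of "snd z"] by simp
      have mem: "z \<in> (\<lambda>x. (x, f x)) ` coordinate_cube B \<longleftrightarrow>
          fst z \<in> coordinate_cube B \<and> snd z = f (fst z)" for z
        by (cases z) auto
      show ?thesis
      proof (rule set_eqI)
        fix z
        show "z \<in> (\<lambda>x. (x, f x)) ` coordinate_cube B \<longleftrightarrow> z \<in> {z. fst z \<in> coordinate_cube B} \<inter>
            {z. \<delta>\<^sup>2 - (snd z - P) \<bullet> (snd z - P) > 0} \<inter> {z. \<forall>b\<in>Basis. z \<in> {z. q b z = 0}}"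
          unfolding mem using key[of z] by blast
      qed
    qed
    have snd_poly: "real_polynomial_function (\<lambda>z::'a\<times>'a. p (snd z))" if "real_polynomial_function p" for p
      using real_polynomial_function_compose[OF polynomial_function_bounded_linear[OF bounded_linear_snd] that]
      by (simp add: o_def)
    have poly_fst: "polynomial_function (fst :: 'a\<times>'a \<Rightarrow> 'a)"
      and poly_snd: "polynomial_function (snd :: 'a\<times>'a \<Rightarrow> 'a)"
      by (simp_all add: polynomial_function_bounded_linear bounded_linear_fst bounded_linear_snd)
    have "real_polynomial_function (q b)" if "b \<in> Basis" for b
    proof (cases "b \<in> B")
      case True
      then show ?thesis unfolding q_def by simp (intro polynomial_intros poly_fst poly_snd)
    next
      case False
      with poly[OF \<gamma>_J[OF that False]] show ?thesis
        unfolding q_def by simp (intro polynomial_intros snd_poly; simp)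
    qed
    then have "semialgebraic {z. \<forall>b\<in>Basis. z \<in> {z. q b z = 0}}"
      by (intro semialgebraic_INT semialgebraic_equation) auto
    moreover have "semialgebraic {z::'a\<times>'a. \<delta>\<^sup>2 - (snd z - P) \<bullet> (snd z - P) > 0}"
      by (intro semialgebraic.positive polynomial_intros poly_snd)
    moreover have "semialgebraic {z::'a\<times>'a. fst z \<in> coordinate_cube B}"
      using finite_subset[OF B(1)] by (intro semialgebraic_coordinate_cube bounded_linear_fst) simp
    ultimately show ?thesis
      unfolding semialgebraic_map_on_def graph by (intro semialgebraic_Int)
  qed
  moreover have "DIM('a) - card K \<le> card B" using B(2) card_S by simp
  ultimately show ?thesis unfolding contains_cube_def using B(1) by blast
qed

text \<open>
  At a generic point, every independence of gradients that occurs anywhere occurs. So if a maximal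
  independent subfamily \<open>K\<close> of \<open>J\<close> is chosen at \<open>P\<close>, then no larger subfamily is independent at any other
  point, and \<open>K\<close> spans the gradients of \<open>J\<close> in a whole neighborhood of \<open>P\<close>.
\<close>

lemma generic_level_set_contains_cube:
  fixes H :: "(('a::euclidean_space \<Rightarrow> real) \<times> ('a \<Rightarrow> real)) set"
  assumes "finite H"
    and poly: "\<And>h. h \<in> H \<Longrightarrow> real_polynomial_function (fst h) \<and> real_polynomial_function (snd h)"
  obtains F where "finite F" "\<And>p. p \<in> F \<Longrightarrow> real_polynomial_function p"
    "\<And>P J U. \<lbrakk>generic_for F P; J \<subseteq> H; \<And>h. h \<in> J \<Longrightarrow> snd h P \<noteq> 0; open U; P \<in> U\<rbrakk> \<Longrightarrow>
       contains_cube {Q \<in> U. \<forall>h\<in>J. snd h Q \<noteq> 0 \<and> ratio h Q = ratio h P} (DIM('a) - card J)"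
proof -
  have "\<forall>h\<in>H. \<exists>G. polynomial_function G \<and> (\<forall>x. snd h x \<noteq> 0 \<longrightarrow>
      (ratio h has_derivative (\<lambda>v. ((1 / (snd h x)\<^sup>2) *\<^sub>R G x) \<bullet> v)) (at x))"
  proof
    fix h assume "h \<in> H"
    then obtain N D where N: "polynomial_function N" "\<And>x. (fst h has_derivative (\<lambda>v. N x \<bullet> v)) (at x)"
      and D: "polynomial_function D" "\<And>x. (snd h has_derivative (\<lambda>v. D x \<bullet> v)) (at x)"
      using poly real_polynomial_function_gradient by meson
    \<comment> \<open>The quotient rule, without the denominator.\<close>
    define G where "G = (\<lambda>x. snd h x *\<^sub>R N x - fst h x *\<^sub>R D x)"
    have "polynomial_function G"
      unfolding G_def using poly[OF \<open>h \<in> H\<close>] N(1) D(1) by (intro polynomial_intros) auto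
    moreover have "(ratio h has_derivative (\<lambda>v. ((1 / (snd h x)\<^sup>2) *\<^sub>R G x) \<bullet> v)) (at x)"
      if "snd h x \<noteq> 0" for x
      by (rule has_derivative_eq_rhs[OF has_derivative_divide'[OF N(2) D(2) that]])
         (use that in \<open>auto simp: G_def inner_diff_left power2_eq_square field_simps\<close>)
    ultimately show "\<exists>G. polynomial_function G \<and> (\<forall>x. snd h x \<noteq> 0 \<longrightarrow>
      (ratio h has_derivative (\<lambda>v. ((1 / (snd h x)\<^sup>2) *\<^sub>R G x) \<bullet> v)) (at x))" by blast
  qed
  from bchoice[OF this] obtain G where G: "\<And>h. h \<in> H \<Longrightarrow> polynomial_function (G h)"
    and deriv: "\<And>h x. \<lbrakk>h \<in> H; snd h x \<noteq> 0\<rbrakk> \<Longrightarrow>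
      (ratio h has_derivative (\<lambda>v. ((1 / (snd h x)\<^sup>2) *\<^sub>R G h x) \<bullet> v)) (at x)" by blast
  have "\<forall>K\<in>Pow H. \<exists>p. real_polynomial_function p \<and> (\<forall>Q. p Q \<noteq> 0 \<longleftrightarrow> independent_family (\<lambda>h. G h Q) K)"
  proof
    fix K assume "K \<in> Pow H"
    then have "finite K" "\<forall>h\<in>K. polynomial_function (G h)"
      using \<open>finite H\<close> G finite_subset by blast+
    from polynomial_cramer_rule[of K G, OF this] obtain p where "real_polynomial_function p"
      and "\<forall>Q. p Q \<noteq> 0 \<longleftrightarrow> independent_family (\<lambda>h. G h Q) K" by (elim exE conjE)
    then show "\<exists>p. real_polynomial_function p \<and> (\<forall>Q. p Q \<noteq> 0 \<longleftrightarrow> independent_family (\<lambda>h. G h Q) K)"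
      by (intro exI[of _ p] conjI)
  qed
  from bchoice[OF this] obtain p where "\<forall>K\<in>Pow H. real_polynomial_function (p K) \<and>
      (\<forall>Q. p K Q \<noteq> 0 \<longleftrightarrow> independent_family (\<lambda>h. G h Q) K)" by (elim exE)
  then have p: "real_polynomial_function (p K)"
    and p_iff: "p K Q \<noteq> 0 \<longleftrightarrow> independent_family (\<lambda>h. G h Q) K" if "K \<subseteq> H" for K Q
    using that by simp_all
  show thesis
  proof (rule that[of "p ` Pow H"])
    show "finite (p ` Pow H)" using \<open>finite H\<close> by simp
    show "real_polynomial_function q" if "q \<in> p ` Pow H" for q using that p by auto
    fix P J U assume generic: "generic_for (p ` Pow H) P" and "J \<subseteq> H"
      and nz: "\<And>h. h \<in> J \<Longrightarrow> snd h P \<noteq> 0" and "open U" "P \<in> U"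
    have "finite J" using \<open>finite H\<close> \<open>J \<subseteq> H\<close> finite_subset by blast
    have "p {} P \<noteq> 0" by (simp add: p_iff independent_empty)
    then have "{} \<in> {K. K \<subseteq> J \<and> p K P \<noteq> 0}" by simp
    from finite_has_maximal2[OF _ this] obtain K where K: "K \<subseteq> J" "p K P \<noteq> 0"
      and maximal: "\<And>L. \<lbrakk>L \<subseteq> J; p L P \<noteq> 0; K \<subseteq> L\<rbrakk> \<Longrightarrow> K = L"
      using \<open>finite J\<close> by auto
    have KH: "K \<subseteq> H" using K(1) \<open>J \<subseteq> H\<close> by blast
    have dep: "G h Q \<in> span ((\<lambda>h. G h Q) ` K)" if "h \<in> J" "p K Q \<noteq> 0" for h Q
    proof (cases "h \<in> K")
      case True
      then show ?thesis by (intro span_base) auto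
    next
      case False
      have sub: "insert h K \<subseteq> H" using KH that(1) \<open>J \<subseteq> H\<close> by blast
      have "p (insert h K) P = 0" using maximal[of "insert h K"] K(1) that(1) False by blast
      then have "p (insert h K) Q = 0"
        using generic sub unfolding generic_for_def by blast
      then show ?thesis
        using p_iff[OF sub, of Q] p_iff[OF KH, of Q] that(2)
          independent_family_insert[OF False, of "\<lambda>h. G h Q"] by blast
    qed
    define N where "N = U \<inter> (\<Inter>h\<in>J. {Q. snd h Q \<noteq> 0}) \<inter> {Q. p K Q \<noteq> 0}"
    have poly_cont: "continuous_on A q" if "real_polynomial_function q" for A and q :: "'a \<Rightarrow> real"
      using that by (intro differentiable_imp_continuous_on differentiable_on_real_polynomial_function)
    have poly_open: "open {Q. q Q \<noteq> 0}" if "real_polynomial_function q" for q :: "'a \<Rightarrow> real"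
      using poly_cont[OF that] by (intro open_Collect_neq continuous_on_const)
    have "contains_cube {Q \<in> N. \<forall>h\<in>J. ratio h Q = ratio h P} (DIM('a) - card K)"
    proof (rule constant_rank_level_set_contains_cube[where G = G and c = "\<lambda>h x. 1 / (snd h x)\<^sup>2"])
      show "finite J" "K \<subseteq> J" by fact+
      show "open N"
        unfolding N_def using \<open>open U\<close> \<open>finite J\<close> poly \<open>J \<subseteq> H\<close> p[OF KH]
        by (intro open_Int open_INT poly_open ballI) auto
      show "P \<in> N" using \<open>P \<in> U\<close> nz K(2) by (simp add: N_def)
      show "real_polynomial_function (fst h) \<and> real_polynomial_function (snd h)" if "h \<in> J" for h
        using that poly \<open>J \<subseteq> H\<close> by blast
      show nzN: "snd h Q \<noteq> 0" if "h \<in> J" "Q \<in> N" for h Q using that by (simp add: N_def)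
      show "continuous_on N (G h)" if "h \<in> J" for h
        using that G \<open>J \<subseteq> H\<close> by (intro continuous_on_polymonial_function) blast
      show "1 / (snd h Q)\<^sup>2 \<noteq> 0" if "h \<in> J" "Q \<in> N" for h Q using nzN[OF that] by simp
      show "continuous_on N (\<lambda>x. 1 / (snd h x)\<^sup>2)" if "h \<in> J" for h
      proof -
        have "real_polynomial_function (snd h)" using that poly \<open>J \<subseteq> H\<close> by blast
        then show ?thesis using nzN[OF that] by (intro continuous_intros poly_cont) simp_all
      qed
      show "(ratio h has_derivative (\<lambda>v. ((1 / (snd h Q)\<^sup>2) *\<^sub>R G h Q) \<bullet> v)) (at Q)"
        if "h \<in> J" "Q \<in> N" for h Q
        using deriv[of h Q] nzN[OF that] that(1) \<open>J \<subseteq> H\<close> by blast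
      show "independent_family (\<lambda>h. G h P) K" using K(2) p_iff[OF KH] by simp
      show "G h Q \<in> span ((\<lambda>h. G h Q) ` K)" if "h \<in> J" "Q \<in> N" for h Q
        using that by (intro dep) (auto simp: N_def)
    qed
    moreover have "{Q \<in> N. \<forall>h\<in>J. ratio h Q = ratio h P} \<subseteq>
        {Q \<in> U. \<forall>h\<in>J. snd h Q \<noteq> 0 \<and> ratio h Q = ratio h P}"
      by (auto simp: N_def)
    moreover have "DIM('a) - card J \<le> DIM('a) - card K"
      using card_mono[OF \<open>finite J\<close> K(1)] by simp
    ultimately show "contains_cube {Q \<in> U. \<forall>h\<in>J. snd h Q \<noteq> 0 \<and> ratio h Q = ratio h P} (DIM('a) - card J)"
      unfolding contains_cube_def by (meson order_trans)
  qed
qed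


section \<open>Bars and homology\<close>

lemma boundary_zero: "boundary (\<lambda>_. 0) = (\<lambda>_. 0)"
  by (auto simp: boundary_def)

lemma boundary_diff:
  "boundary (\<lambda>\<sigma>. c \<sigma> - d \<sigma>) = (\<lambda>\<tau>. boundary c \<tau> - boundary d \<tau>)"
  by (rule ext) (simp add: boundary_def right_diff_distrib sum_subtractf)

lemma simplicial_chains_zero: "(\<lambda>_. 0) \<in> simplicial_chains q K"
  by (simp add: simplicial_chains_def)

lemma simplicial_chains_diff:
  "c \<in> simplicial_chains q K \<Longrightarrow> d \<in> simplicial_chains q K \<Longrightarrow> (\<lambda>\<sigma>. c \<sigma> - d \<sigma>) \<in> simplicial_chains q K"
  unfolding simplicial_chains_def by simp (metis diff_self)

lemma zero_in_boundaries: "(\<lambda>_. 0) \<in> boundaries q K"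
  unfolding boundaries_def by (rule image_eqI[where x = "\<lambda>_. 0"]) (simp_all add: boundary_zero simplicial_chains_zero)

lemma boundaries_diff:
  assumes "c \<in> boundaries q K" and "d \<in> boundaries q K"
  shows "(\<lambda>\<sigma>. c \<sigma> - d \<sigma>) \<in> boundaries q K"
proof -
  from assms obtain e f where "e \<in> simplicial_chains (Suc q) K" "f \<in> simplicial_chains (Suc q) K"
    and "c = boundary e" "d = boundary f" unfolding boundaries_def by blast
  then show ?thesis
    unfolding boundaries_def
    by (intro image_eqI[where x = "\<lambda>\<sigma>. e \<sigma> - f \<sigma>"]) (simp_all add: boundary_diff simplicial_chains_diff)
qed

lemma equiv_homologous: "equiv (cycles q K) (homologous q K)"
proof (rule equivI)
  show "homologous q K \<subseteq> cycles q K \<times> cycles q K" by (auto simp: homologous_def)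
  show "refl_on (cycles q K) (homologous q K)"
    by (auto simp: refl_on_def homologous_def zero_in_boundaries)
  show "sym (homologous q K)"
  proof (rule symI)
    fix z w assume zw: "(z, w) \<in> homologous q K"
    then have "(\<lambda>\<sigma>. z \<sigma> - w \<sigma>) \<in> boundaries q K" by (simp add: homologous_def)
    from boundaries_diff[OF zero_in_boundaries this]
    have "(\<lambda>\<sigma>. 0 - (z \<sigma> - w \<sigma>)) \<in> boundaries q K" .
    with zw show "(w, z) \<in> homologous q K" by (simp add: homologous_def)
  qed
  show "trans (homologous q K)"
  proof (rule transI)
    fix x y z assume xy: "(x, y) \<in> homologous q K" and yz: "(y, z) \<in> homologous q K"
    then have 1: "(\<lambda>\<sigma>. x \<sigma> - y \<sigma>) \<in> boundaries q K"
      and 2: "(\<lambda>\<sigma>. y \<sigma> - z \<sigma>) \<in> boundaries q K" by (auto simp: homologous_def)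
    from boundaries_diff[OF 1 boundaries_diff[OF zero_in_boundaries 2]]
    have "(\<lambda>\<sigma>. (x \<sigma> - y \<sigma>) - (0 - (y \<sigma> - z \<sigma>))) \<in> boundaries q K" .
    with xy yz show "(x, z) \<in> homologous q K" by (simp add: homologous_def)
  qed
qed

lemma homology_module_simps:
  "pm_space (homology_module q X) t = cycles q (X t) // homologous q (X t)"
  "pm_map (homology_module q X) s t U = (\<Union>z\<in>U. homologous q (X t) `` {z})"
  by (simp_all add: homology_module_def)

lemma homology_map_constant:
  assumes "X s = X t" and "U \<in> pm_space (homology_module q X) s"
  shows "pm_map (homology_module q X) s t U = U"
proof -
  from assms(2) have "U \<in> cycles q (X t) // homologous q (X t)"
    unfolding homology_module_simps assms(1) .
  then obtain z where U: "U = homologous q (X t) `` {z}" and z: "z \<in> cycles q (X t)"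
    by (rule quotientE)
  have "homologous q (X t) `` {w} = U" if "w \<in> U" for w
  proof -
    from that have "(z, w) \<in> homologous q (X t)" by (simp add: U)
    from equiv_class_eq[OF equiv_homologous this] show ?thesis by (simp add: U)
  qed
  moreover have "z \<in> U" using equiv_class_self[OF equiv_homologous z] by (simp add: U)
  ultimately show ?thesis unfolding homology_module_simps by blast
qed

lemma barcode_module_simps:
  "pm_space (barcode_module B :: ('f::field, _) persistence_module) t =
     (\<Pi>\<^sub>E j\<in>(SIGMA I:set_mset B. {..<count B I}). if t \<in> fst j then UNIV else {0})"
  "pm_map (barcode_module B :: ('f::field, _) persistence_module) s t x =
     (\<lambda>j\<in>(SIGMA I:set_mset B. {..<count B I}). if s \<in> fst j \<and> t \<in> fst j then x j else 0)"
  by (auto simp: barcode_module_def direct_sum_module_def interval_module_def case_prod_beta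
      cong: PiE_cong restrict_cong)

text \<open>
  The element with value \<open>a\<close> in the first copy of the bar \<open>I\<close> and \<open>0\<close> in all other summands.
\<close>

definition bar_element :: "real set multiset \<Rightarrow> real set \<Rightarrow> 'f::field \<Rightarrow> real set \<times> nat \<Rightarrow> 'f" where
  "bar_element B I a =
     (\<lambda>j\<in>(SIGMA I:set_mset B. {..<count B I}). if j = (I, 0) then a else 0)"

lemma bar_element_in_space:
  "a = 0 \<or> t \<in> I \<Longrightarrow> bar_element B I a \<in> pm_space (barcode_module B) t"
  by (auto simp: bar_element_def barcode_module_simps)

lemma bar_element_at: "I \<in># B \<Longrightarrow> bar_element B I a (I, 0) = a"
  by (simp add: bar_element_def)

text \<open>
  As long as the complex does not change, the structure map is the identity on homology. It would not
  be injective in the barcode module if a bar ended in between, nor surjective if one began.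
\<close>

lemma bar_membership_constant:
  assumes iso: "pm_iso (homology_module q X :: ('f::field, _) persistence_module) (barcode_module B)"
    and const: "X s = X t" and "s \<le> t" and I: "I \<in># B"
  shows "s \<in> I \<longleftrightarrow> t \<in> I"
proof -
  let ?M = "homology_module q X :: ('f, _) persistence_module"
  let ?N = "barcode_module B :: ('f, _) persistence_module"
  from iso obtain f where bij: "\<And>t. bij_betw (f t) (pm_space ?M t) (pm_space ?N t)"
    and nat: "\<And>s t U. s \<le> t \<Longrightarrow> U \<in> pm_space ?M s \<Longrightarrow> f t (pm_map ?M s t U) = pm_map ?N s t (f s U)"
    unfolding pm_iso_def by blast
  have map: "pm_map ?N s t (f s U) = f t U" if "U \<in> pm_space ?M s" for U
    using nat[OF \<open>s \<le> t\<close> that] homology_map_constant[of X s t U q] const that by simp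
  have space: "pm_space ?M s = pm_space ?M t" using const by (simp add: homology_module_simps)
  have "inj_on (pm_map ?N s t) (pm_space ?N s)"
  proof (rule inj_onI)
    fix x y assume xy: "x \<in> pm_space ?N s" "y \<in> pm_space ?N s" "pm_map ?N s t x = pm_map ?N s t y"
    then obtain U V where "U \<in> pm_space ?M s" "x = f s U" "V \<in> pm_space ?M s" "y = f s V"
      using bij_betw_imp_surj_on[OF bij[of s]] by (metis (no_types, lifting) imageE)
    with xy map have "f t U = f t V" by simp
    with \<open>U \<in> pm_space ?M s\<close> \<open>V \<in> pm_space ?M s\<close> have "U = V"
      using bij_betw_imp_inj_on[OF bij[of t]] space by (auto dest: inj_onD)
    then show "x = y" using \<open>x = f s U\<close> \<open>y = f s V\<close> by simp
  qed
  moreover have "\<exists>x. y = pm_map ?N s t x" if "y \<in> pm_space ?N t" for y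
  proof -
    from that obtain U where "U \<in> pm_space ?M t" "y = f t U"
      using bij_betw_imp_surj_on[OF bij[of t]] by (metis (no_types, lifting) imageE)
    with map space show ?thesis by metis
  qed
  moreover have "bar_element B I (1::'f) \<noteq> bar_element B I 0"
    using bar_element_at[OF I] by (metis zero_neq_one)
  moreover have "pm_map ?N s t (bar_element B I 1) = pm_map ?N s t (bar_element B I 0)" if "t \<notin> I"
    using that by (auto simp: barcode_module_simps bar_element_def intro!: restrict_ext)
  moreover have "pm_map ?N s t x (I, 0) = 0" if "s \<notin> I" for x
    using that I by (simp add: barcode_module_simps)
  ultimately show ?thesis
    using bar_element_in_space[of "1::'f" s I B] bar_element_in_space[of "1::'f" t I B]
      bar_element_in_space[of "0::'f" s I B] bar_element_at[OF I, of "1::'f"]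
    by (metis inj_onD zero_neq_one)
qed

lemma bij_betw_has_two_elements:
  assumes "bij_betw f A B"
  shows "(\<exists>x y. x \<in> A \<and> y \<in> A \<and> x \<noteq> y) \<longleftrightarrow> (\<exists>x y. x \<in> B \<and> y \<in> B \<and> x \<noteq> y)"
proof
  assume "\<exists>x y. x \<in> A \<and> y \<in> A \<and> x \<noteq> y"
  then obtain x y where "x \<in> A" "y \<in> A" "x \<noteq> y" by blast
  with assms show "\<exists>x y. x \<in> B \<and> y \<in> B \<and> x \<noteq> y"
    by (intro exI[of _ "f x"] exI[of _ "f y"]) (auto simp: bij_betw_def inj_on_def)
next
  assume "\<exists>x y. x \<in> B \<and> y \<in> B \<and> x \<noteq> y"
  then obtain x y where "x \<in> B" "y \<in> B" "x \<noteq> y" by blast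
  with assms show "\<exists>x y. x \<in> A \<and> y \<in> A \<and> x \<noteq> y"
    unfolding bij_betw_def by (metis imageE)
qed

lemma bar_covers_iff_homology_nontrivial:
  assumes iso: "pm_iso (homology_module q X :: ('f::field, _) persistence_module) (barcode_module B)"
  shows "(\<exists>I\<in>#B. t \<in> I) \<longleftrightarrow>
    (\<exists>U V. U \<in> pm_space (homology_module q X :: ('f, _) persistence_module) t \<and>
           V \<in> pm_space (homology_module q X :: ('f, _) persistence_module) t \<and> U \<noteq> V)"
proof -
  let ?M = "homology_module q X :: ('f, _) persistence_module"
  let ?N = "barcode_module B :: ('f, _) persistence_module"
  from iso obtain f where "bij_betw (f t) (pm_space ?M t) (pm_space ?N t)"
    unfolding pm_iso_def by blast
  then have "(\<exists>U V. U \<in> pm_space ?M t \<and> V \<in> pm_space ?M t \<and> U \<noteq> V) \<longleftrightarrow>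
      (\<exists>x y. x \<in> pm_space ?N t \<and> y \<in> pm_space ?N t \<and> x \<noteq> y)"
    by (rule bij_betw_has_two_elements)
  also have "\<dots> \<longleftrightarrow> (\<exists>I\<in>#B. t \<in> I)"
  proof
    assume "\<exists>I\<in>#B. t \<in> I"
    then obtain I where I: "I \<in># B" "t \<in> I" by blast
    moreover have "bar_element B I (1::'f) \<noteq> bar_element B I 0"
      using bar_element_at[OF I(1)] by (metis zero_neq_one)
    ultimately show "\<exists>x y. x \<in> pm_space ?N t \<and> y \<in> pm_space ?N t \<and> x \<noteq> y"
      using bar_element_in_space by blast
  next
    assume "\<exists>x y. x \<in> pm_space ?N t \<and> y \<in> pm_space ?N t \<and> x \<noteq> y"
    then obtain x y where xy: "x \<in> pm_space ?N t" "y \<in> pm_space ?N t" "x \<noteq> y" by blast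
    show "\<exists>I\<in>#B. t \<in> I"
    proof (rule ccontr)
      assume no: "\<not> (\<exists>I\<in>#B. t \<in> I)"
      have "x j = y j" if "j \<in> (SIGMA I:set_mset B. {..<count B I})" for j
      proof -
        from that no have "t \<notin> fst j" by auto
        then show ?thesis
          using PiE_mem[OF xy(1)[unfolded barcode_module_simps] that]
            PiE_mem[OF xy(2)[unfolded barcode_module_simps] that] by simp
      qed
      then have "x = y"
        by (rule PiE_ext[OF xy(1)[unfolded barcode_module_simps] xy(2)[unfolded barcode_module_simps]])
      with xy show False by simp
    qed
  qed
  finally show ?thesis by (rule sym)
qed

lemma bar_avoids_empty_complex:
  assumes "pm_iso (homology_module q X :: ('f::field, _) persistence_module) (barcode_module B)"
    and "X t = {}" and "I \<in># B"
  shows "t \<notin> I"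
proof
  assume "t \<in> I"
  with assms(3) have "\<exists>I\<in>#B. t \<in> I" by blast
  from iffD1[OF bar_covers_iff_homology_nontrivial[OF assms(1)] this] obtain U V where UV: "U \<in> pm_space (homology_module q X :: ('f, _) persistence_module) t"
    "V \<in> pm_space (homology_module q X :: ('f, _) persistence_module) t" "U \<noteq> V"
    by (elim exE conjE)
  have no_cycles: "z = (\<lambda>_. 0)" if "z \<in> cycles q {}" for z :: "_ \<Rightarrow> 'f"
    using that by (auto simp: cycles_def simplicial_chains_def)
  have "W = homologous q {} `` {\<lambda>_. 0}"
    if "W \<in> cycles q {} // homologous q {}" for W :: "(_ \<Rightarrow> 'f) set"
  proof -
    from that obtain z where "W = homologous q {} `` {z}" "z \<in> cycles q {}" by (rule quotientE)
    with no_cycles[of z] show ?thesis by simp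
  qed
  with UV(1,2) assms(2) have "U = homologous q {} `` {\<lambda>_. 0}" "V = homologous q {} `` {\<lambda>_. 0}"
    by (simp_all add: homology_module_simps)
  with UV(3) show False by simp
qed

text \<open>
  Without edges there are no boundaries in degree 0, so a vertex is a nonzero class.
\<close>

lemma bar_covers_discrete_complex:
  fixes X :: "real \<Rightarrow> 'v::{finite,linorder} set set"
  assumes iso: "pm_iso (homology_module 0 X :: ('f::field, _) persistence_module) (barcode_module B)"
    and vertex: "{v} \<in> X t" and discrete: "\<And>\<sigma>. \<sigma> \<in> X t \<Longrightarrow> card \<sigma> \<noteq> 2"
  shows "\<exists>I\<in>#B. t \<in> I"
proof -
  define c :: "'v set \<Rightarrow> 'f" where "c = (\<lambda>\<sigma>. if \<sigma> = {v} then 1 else 0)"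
  have "c (insert u \<tau>) = 0" if "\<tau> \<noteq> {}" "u \<in> - \<tau>" for u \<tau>
    using that by (auto simp: c_def)
  then have "boundary c \<tau> = 0" for \<tau>
    unfolding boundary_def by (auto intro!: sum.neutral)
  then have c: "c \<in> cycles 0 (X t)"
    using vertex by (auto simp: cycles_def simplicial_chains_def c_def)
  have zero: "(\<lambda>_. 0) \<in> cycles 0 (X t)"
    by (simp add: cycles_def simplicial_chains_zero boundary_zero)
  have "d = (\<lambda>_. 0)" if "d \<in> simplicial_chains (Suc 0) (X t)" for d :: "'v set \<Rightarrow> 'f"
    using that discrete by (auto simp: simplicial_chains_def numeral_2_eq_2)
  then have "b = (\<lambda>_. 0)" if "b \<in> boundaries 0 (X t)" for b :: "'v set \<Rightarrow> 'f"
    using that boundary_zero by (auto simp: boundaries_def)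
  moreover have "c {v} \<noteq> 0" by (simp add: c_def)
  ultimately have "c \<notin> boundaries 0 (X t)" by metis
  then have "(c, \<lambda>_. 0) \<notin> homologous 0 (X t)" by (simp add: homologous_def)
  then have "homologous 0 (X t) `` {c} \<noteq> homologous 0 (X t) `` {\<lambda>_. 0}"
    using eq_equiv_class[OF _ equiv_homologous zero] by blast
  then show ?thesis
    using quotientI[OF c] quotientI[OF zero]
    by (intro iffD2[OF bar_covers_iff_homology_nontrivial[OF iso]] exI conjI)
       (auto simp: homology_module_simps)
qed


section \<open>Sublevel filtrations of a radius function\<close>

lemma homology_module_cong:
  assumes "X t = Y t'"
  shows "pm_space (homology_module q X) t = pm_space (homology_module q Y) t'"
    and "pm_add (homology_module q X) t = pm_add (homology_module q Y) t'"
    and "pm_scale (homology_module q X) t = pm_scale (homology_module q Y) t'"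
    and "X s = Y s' \<Longrightarrow> pm_map (homology_module q X) s t = pm_map (homology_module q Y) s' t'"
  using assms by (simp_all add: homology_module_def)

lemma barcode_module_cong:
  assumes t: "\<And>I. I \<in># B \<Longrightarrow> t \<in> I \<longleftrightarrow> t' \<in> I"
  shows "pm_space (barcode_module B) t = pm_space (barcode_module B) t'"
    and "pm_add (barcode_module B) t = pm_add (barcode_module B) t'"
    and "pm_scale (barcode_module B) t = pm_scale (barcode_module B) t'"
    and "(\<And>I. I \<in># B \<Longrightarrow> s \<in> I \<longleftrightarrow> s' \<in> I) \<Longrightarrow>
      pm_map (barcode_module B) s t = pm_map (barcode_module B) s' t'"
proof -
  let ?J = "SIGMA I:set_mset B. {..<count B I}"
  have t_iff: "t \<in> fst j \<longleftrightarrow> t' \<in> fst j" if "j \<in> ?J" for j using that t by auto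
  show "pm_space (barcode_module B) t = pm_space (barcode_module B) t'"
    unfolding barcode_module_simps by (rule PiE_cong) (simp only: t_iff)
  show "pm_map (barcode_module B) s t = pm_map (barcode_module B) s' t'"
    if s: "\<And>I. I \<in># B \<Longrightarrow> s \<in> I \<longleftrightarrow> s' \<in> I"
  proof -
    have s_iff: "s \<in> fst j \<longleftrightarrow> s' \<in> fst j" if "j \<in> ?J" for j using that s by auto
    show ?thesis
      by (rule ext, unfold barcode_module_simps, rule restrict_ext) (simp only: s_iff t_iff)
  qed
  show "pm_add (barcode_module B) t = pm_add (barcode_module B) t'"
    by (simp add: barcode_module_def direct_sum_module_def interval_module_def case_prod_beta)
  show "pm_scale (barcode_module B) t = pm_scale (barcode_module B) t'"
    by (simp add: barcode_module_def direct_sum_module_def interval_module_def case_prod_beta)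
qed

text \<open>
  The isomorphism at time \<open>t\<close> is the given one at time \<open>\<psi> t\<close>. Monotonicity of \<open>\<psi>\<close> suffices; it need not
  be bijective as long as no bar separates \<open>t\<close> from \<open>\<psi> t\<close>.
\<close>

lemma has_persistent_homology_reparametrize:
  assumes D: "has_persistent_homology TYPE('f::field) X D"
    and "mono \<psi>" and complexes: "\<And>t. Y t = X (\<psi> t)"
    and bars: "\<And>i I t. I \<in># D i \<Longrightarrow> t \<in> I \<longleftrightarrow> \<psi> t \<in> I"
  shows "has_persistent_homology TYPE('f) Y D"
  unfolding has_persistent_homology_def
proof (intro allI conjI)
  fix i
  show "is_barcode (D i)" using D by (simp add: has_persistent_homology_def)
  let ?M = "homology_module i X :: ('f, _) persistence_module"
  let ?M' = "homology_module i Y :: ('f, _) persistence_module"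
  let ?N = "barcode_module (D i) :: ('f, _) persistence_module"
  have M': "pm_space ?M' t = pm_space ?M (\<psi> t)" "pm_add ?M' t = pm_add ?M (\<psi> t)"
      "pm_scale ?M' t = pm_scale ?M (\<psi> t)" "pm_map ?M' s t = pm_map ?M (\<psi> s) (\<psi> t)" for s t
    by (intro homology_module_cong complexes)+
  have N: "pm_space ?N t = pm_space ?N (\<psi> t)" "pm_add ?N t = pm_add ?N (\<psi> t)"
      "pm_scale ?N t = pm_scale ?N (\<psi> t)" "pm_map ?N s t = pm_map ?N (\<psi> s) (\<psi> t)" for s t
    by (intro barcode_module_cong bars; assumption)+
  from D have "pm_iso ?M ?N" by (simp add: has_persistent_homology_def)
  then obtain f where bij: "\<forall>t. bij_betw (f t) (pm_space ?M t) (pm_space ?N t)"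
    and add: "\<forall>t. \<forall>x\<in>pm_space ?M t. \<forall>y\<in>pm_space ?M t.
        f t (pm_add ?M t x y) = pm_add ?N t (f t x) (f t y)"
    and scale: "\<forall>t a. \<forall>x\<in>pm_space ?M t. f t (pm_scale ?M t a x) = pm_scale ?N t a (f t x)"
    and map: "\<forall>s t. s \<le> t \<longrightarrow> (\<forall>x\<in>pm_space ?M s. f t (pm_map ?M s t x) = pm_map ?N s t (f s x))"
    unfolding pm_iso_def by (elim exE conjE)
  show "pm_iso ?M' ?N"
    unfolding pm_iso_def
  proof (intro exI[of _ "\<lambda>t. f (\<psi> t)"] conjI allI ballI impI)
    fix t
    show "bij_betw (f (\<psi> t)) (pm_space ?M' t) (pm_space ?N t)"
      using bij by (simp add: M'(1) N(1)[of t])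
    fix x assume x: "x \<in> pm_space ?M' t"
    show "f (\<psi> t) (pm_scale ?M' t a x) = pm_scale ?N t a (f (\<psi> t) x)" for a
      using scale x by (simp add: M'(1,3) N(3)[of t])
    fix y assume y: "y \<in> pm_space ?M' t"
    show "f (\<psi> t) (pm_add ?M' t x y) = pm_add ?N t (f (\<psi> t) x) (f (\<psi> t) y)"
      using add x y by (simp add: M'(1,2) N(2)[of t])
  next
    fix s t :: real and x assume "s \<le> t" and x: "x \<in> pm_space ?M' s"
    then have "\<psi> s \<le> \<psi> t" using \<open>mono \<psi>\<close> by (simp add: monoD)
    with map x
    show "f (\<psi> t) (pm_map ?M' s t x) = pm_map ?N s t (f (\<psi> s) x)"
      by (simp add: M'(1,4) N(4)[of s t])
  qed
qed

definition sublevel_filtration :: "('v set \<Rightarrow> real) \<Rightarrow> real \<Rightarrow> 'v set set" where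
  "sublevel_filtration r t = {\<sigma>. \<sigma> \<noteq> {} \<and> r \<sigma> \<le> t}"

text \<open>
  The filtration is constant between consecutive radii and right continuous at each of them, and it is empty
  before time \<open>0\<close>. So a bar begins and ends at radii; it contains its left endpoint and not its right
  endpoint.
\<close>

lemma sublevel_bar:
  fixes r :: "'v::{finite,linorder} set \<Rightarrow> real"
  assumes D: "has_persistent_homology TYPE('f::field) (sublevel_filtration r) D"
    and nonneg: "\<And>\<sigma>. \<sigma> \<noteq> {} \<Longrightarrow> 0 \<le> r \<sigma>" and I: "I \<in># D i"
  shows "bdd_below I" and "Inf I \<in> r ` (- {{}})" and "bdd_above I \<Longrightarrow> Sup I \<in> r ` (- {{}})"
    and "t \<in> I \<longleftrightarrow> Inf I \<le> t \<and> (bdd_above I \<longrightarrow> t < Sup I)" and "t \<in> I \<Longrightarrow> 0 \<le> t"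
proof -
  define C where "C = r ` (- {{}})"
  have iso: "pm_iso (homology_module i (sublevel_filtration r) :: ('f, _) persistence_module) (barcode_module (D i))"
    and "I \<noteq> {}" and interval: "is_interval I"
    using D I by (auto simp: has_persistent_homology_def is_barcode_def)
  have step: "s \<in> I \<longleftrightarrow> t \<in> I" if "s \<le> t" and gap: "\<And>c. c \<in> C \<Longrightarrow> s < c \<Longrightarrow> t < c" for s t
  proof (rule bar_membership_constant[OF iso _ \<open>s \<le> t\<close> I])
    have "r \<sigma> \<le> s \<longleftrightarrow> r \<sigma> \<le> t" if "\<sigma> \<noteq> {}" for \<sigma>
      using gap[of "r \<sigma>"] that \<open>s \<le> t\<close> by (force simp: C_def)
    then show "sublevel_filtration r s = sublevel_filtration r t"
      by (auto simp: sublevel_filtration_def)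
  qed
  have locally_constant: "\<exists>\<epsilon>>0. \<forall>s t. x - \<epsilon> < s \<longrightarrow> s \<le> t \<longrightarrow> t < x + \<epsilon> \<longrightarrow> (x \<in> C \<longrightarrow> x \<le> s) \<longrightarrow>
      (s \<in> I \<longleftrightarrow> t \<in> I)" for x
  proof -
    have "finite C" by (simp add: C_def)
    then obtain \<epsilon> where \<epsilon>: "\<epsilon> > 0" "\<forall>c\<in>C. c \<noteq> x \<longrightarrow> \<epsilon> \<le> dist x c" using finite_set_avoid by blast
    have "s \<in> I \<longleftrightarrow> t \<in> I" if "x - \<epsilon> < s" "s \<le> t" "t < x + \<epsilon>" "x \<in> C \<longrightarrow> x \<le> s" for s t
    proof (rule step[OF \<open>s \<le> t\<close>], rule ccontr)
      fix c assume c: "c \<in> C" "s < c" "\<not> t < c"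
      with that have "c \<noteq> x" by auto
      with c(1) \<epsilon>(2) have "\<epsilon> \<le> dist x c" by blast
      with c that show False by (simp add: dist_real_def abs_real_def split: if_splits)
    qed
    with \<epsilon>(1) show ?thesis by blast
  qed
  show pos: "0 \<le> t" if "t \<in> I" for t
  proof (rule ccontr)
    assume "\<not> 0 \<le> t"
    then have "\<not> r \<sigma> \<le> t" if "\<sigma> \<noteq> {}" for \<sigma> using nonneg[OF that] by linarith
    then have "sublevel_filtration r t = {}" unfolding sublevel_filtration_def by blast
    with bar_avoids_empty_complex[OF iso this I] that show False by simp
  qed
  show below: "bdd_below I" by (rule bdd_belowI[of _ 0]) (rule pos)
  define a where "a = Inf I"
  have a_le: "a \<le> t" if "t \<in> I" for t using below that by (simp add: a_def cInf_lower)
  have a: "a \<in> C \<and> a \<in> I"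
  proof -
    obtain \<epsilon> where "\<epsilon> > 0" and const: "\<And>s t. \<lbrakk>a - \<epsilon> < s; s \<le> t; t < a + \<epsilon>; a \<in> C \<longrightarrow> a \<le> s\<rbrakk> \<Longrightarrow>
        s \<in> I \<longleftrightarrow> t \<in> I"
      using locally_constant[of a] by blast
    obtain x where x: "x \<in> I" "x < a + \<epsilon>"
      using cInf_lessD[OF \<open>I \<noteq> {}\<close>, of "a + \<epsilon>"] \<open>\<epsilon> > 0\<close> by (auto simp: a_def)
    have "a \<le> x" using a_le[OF x(1)] .
    have "a \<in> I \<longleftrightarrow> x \<in> I" using \<open>a \<le> x\<close> x(2) \<open>\<epsilon> > 0\<close> by (intro const) auto
    moreover have "a - \<epsilon>/2 \<in> I \<longleftrightarrow> x \<in> I" if "a \<notin> C"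
      using \<open>a \<le> x\<close> x(2) \<open>\<epsilon> > 0\<close> that by (intro const) auto
    moreover have "a - \<epsilon>/2 \<notin> I" using a_le[of "a - \<epsilon>/2"] \<open>\<epsilon> > 0\<close> by auto
    ultimately show ?thesis using x(1) by blast
  qed
  then show "Inf I \<in> r ` (- {{}})" by (simp add: a_def C_def)
  define b where "b = Sup I"
  have b: "b \<in> C \<and> b \<notin> I" if above: "bdd_above I"
  proof -
    have le_b: "t \<le> b" if "t \<in> I" for t using above that by (simp add: b_def cSup_upper)
    obtain \<epsilon> where "\<epsilon> > 0" and const: "\<And>s t. \<lbrakk>b - \<epsilon> < s; s \<le> t; t < b + \<epsilon>; b \<in> C \<longrightarrow> b \<le> s\<rbrakk> \<Longrightarrow>
        s \<in> I \<longleftrightarrow> t \<in> I"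
      using locally_constant[of b] by blast
    obtain x where x: "x \<in> I" "b - \<epsilon> < x"
      using less_cSupD[OF \<open>I \<noteq> {}\<close>, of "b - \<epsilon>"] \<open>\<epsilon> > 0\<close> by (auto simp: b_def)
    have "x \<le> b" using le_b[OF x(1)] .
    have "b \<in> I \<longleftrightarrow> b + \<epsilon>/2 \<in> I" using \<open>\<epsilon> > 0\<close> by (intro const) auto
    moreover have "b + \<epsilon>/2 \<notin> I" using le_b[of "b + \<epsilon>/2"] \<open>\<epsilon> > 0\<close> by auto
    moreover have "x \<in> I \<longleftrightarrow> b \<in> I" if "b \<notin> C"
      using \<open>x \<le> b\<close> x(2) \<open>\<epsilon> > 0\<close> that by (intro const) auto
    ultimately show ?thesis using x(1) by blast
  qed
  then show "bdd_above I \<Longrightarrow> Sup I \<in> r ` (- {{}})" by (simp add: b_def C_def)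
  show "t \<in> I \<longleftrightarrow> Inf I \<le> t \<and> (bdd_above I \<longrightarrow> t < Sup I)" for t
    unfolding a_def[symmetric] b_def[symmetric]
  proof
    assume "t \<in> I"
    have "t < b" if "bdd_above I"
    proof -
      have "t \<noteq> b" using b[OF that] \<open>t \<in> I\<close> by metis
      then show ?thesis using cSup_upper[OF \<open>t \<in> I\<close> that] by (simp add: b_def)
    qed
    with a_le[OF \<open>t \<in> I\<close>] show "a \<le> t \<and> (bdd_above I \<longrightarrow> t < b)" by simp
  next
    assume t: "a \<le> t \<and> (bdd_above I \<longrightarrow> t < b)"
    have "\<exists>y\<in>I. t \<le> y"
    proof (cases "bdd_above I")
      case True
      with t have "t < Sup I" by (simp add: b_def)
      from less_cSupD[OF \<open>I \<noteq> {}\<close> this] show ?thesis by (auto intro: less_imp_le)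
    next
      case False
      then show ?thesis unfolding bdd_above_def by (metis linear)
    qed
    then obtain y where "y \<in> I" "t \<le> y" by blast
    with a t interval show "t \<in> I" by (meson is_interval_1)
  qed
qed

lemma bounded_endpoints_subset_radii:
  fixes r :: "'v::{finite,linorder} set \<Rightarrow> real"
  assumes "has_persistent_homology TYPE('f::field) (sublevel_filtration r) D"
    and "\<And>\<sigma>. \<sigma> \<noteq> {} \<Longrightarrow> 0 \<le> r \<sigma>"
  shows "bounded_endpoints D \<subseteq> r ` (- {{}})"
  using sublevel_bar(2,3)[OF assms]
  by (auto simp: bounded_endpoints_def interval_bounded_endpoints_def split: if_splits)

lemma zero_is_bounded_endpoint:
  fixes r :: "'v::{finite,linorder} set \<Rightarrow> real"
  assumes D: "has_persistent_homology TYPE('f::field) (sublevel_filtration r) D"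
    and nonneg: "\<And>\<sigma>. \<sigma> \<noteq> {} \<Longrightarrow> 0 \<le> r \<sigma>"
    and vertex: "r {v} = 0" and edges: "\<And>\<sigma>. card \<sigma> = 2 \<Longrightarrow> r \<sigma> > 0"
  shows "0 \<in> bounded_endpoints D"
proof -
  have "pm_iso (homology_module 0 (sublevel_filtration r) :: ('f, _) persistence_module) (barcode_module (D 0))"
    using D by (simp add: has_persistent_homology_def)
  moreover have "{v} \<in> sublevel_filtration r 0" by (simp add: sublevel_filtration_def vertex)
  moreover have "card \<sigma> \<noteq> 2" if "\<sigma> \<in> sublevel_filtration r 0" for \<sigma>
    using that edges[of \<sigma>] by (auto simp: sublevel_filtration_def)
  ultimately obtain I where I: "I \<in># D 0" "0 \<in> I"
    using bar_covers_discrete_complex by blast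
  have "Inf I = 0"
  proof (rule antisym)
    show "Inf I \<le> 0" using sublevel_bar(1)[OF D nonneg I(1)] I(2) by (rule cInf_lower[rotated])
    show "0 \<le> Inf I" using I sublevel_bar(5)[OF D nonneg I(1)] by (intro cInf_greatest) auto
  qed
  with sublevel_bar(1)[OF D nonneg I(1)] I(1) show ?thesis
    unfolding bounded_endpoints_def interval_bounded_endpoints_def by force
qed

text \<open>
  The reparametrization \<open>\<psi>\<close> sends \<open>t\<close> to the largest radius, in the sense of \<open>r\<close>, of a simplex that is present
  at time \<open>t\<close> in the filtration of \<open>r'\<close>. It moves \<open>t\<close> across no endpoint of a bar, since endpoints are values
  that \<open>r\<close> and \<open>r'\<close> share.
\<close>

lemma has_persistent_homology_same_order:
  fixes r r' :: "'v::{finite,linorder} set \<Rightarrow> real"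
  assumes D: "has_persistent_homology TYPE('f::field) (sublevel_filtration r) D"
    and nonneg: "\<And>\<sigma>. \<sigma> \<noteq> {} \<Longrightarrow> 0 \<le> r \<sigma>"
    and order: "\<And>\<sigma> \<tau>. \<lbrakk>\<sigma> \<noteq> {}; \<tau> \<noteq> {}\<rbrakk> \<Longrightarrow> r \<sigma> \<le> r \<tau> \<longleftrightarrow> r' \<sigma> \<le> r' \<tau>"
    and fixed: "\<And>\<sigma>. \<lbrakk>\<sigma> \<noteq> {}; r \<sigma> \<in> bounded_endpoints D\<rbrakk> \<Longrightarrow> r' \<sigma> = r \<sigma>"
  shows "has_persistent_homology TYPE('f) (sublevel_filtration r') D"
proof -
  define S where "S t = {\<sigma>. \<sigma> \<noteq> {} \<and> r' \<sigma> \<le> t}" for t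
  \<comment> \<open>The value \<open>-1\<close> stands for a time before the first simplex.\<close>
  define \<psi> where "\<psi> t = Max (insert (-1) (r ` S t))" for t
  have fin: "finite (insert (-1) (r ` S t))" for t by simp
  have le_\<psi>: "r \<sigma> \<le> \<psi> t \<longleftrightarrow> r' \<sigma> \<le> t" if "\<sigma> \<noteq> {}" for \<sigma> t
  proof
    assume "r \<sigma> \<le> \<psi> t"
    moreover have "\<psi> t \<in> insert (-1) (r ` S t)" unfolding \<psi>_def by (rule Max_in) auto
    ultimately obtain \<tau> where "\<tau> \<in> S t" "r \<sigma> \<le> r \<tau>" using nonneg[OF \<open>\<sigma> \<noteq> {}\<close>] by force
    then show "r' \<sigma> \<le> t" using order[OF that, of \<tau>] by (auto simp: S_def)
  next
    assume "r' \<sigma> \<le> t"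
    then show "r \<sigma> \<le> \<psi> t" unfolding \<psi>_def using that by (intro Max_ge) (auto simp: S_def)
  qed
  have endpoint: "e \<le> t \<longleftrightarrow> e \<le> \<psi> t" if "e \<in> bounded_endpoints D" for e t
  proof -
    from that bounded_endpoints_subset_radii[OF D nonneg] obtain \<sigma> where "\<sigma> \<noteq> {}" "e = r \<sigma>" by blast
    with le_\<psi>[of \<sigma> t] fixed[of \<sigma>] that show ?thesis by simp
  qed
  show ?thesis
  proof (rule has_persistent_homology_reparametrize[OF D])
    show "mono \<psi>"
      unfolding \<psi>_def by (intro monoI Max_mono insert_mono image_mono) (auto simp: S_def)
    show "sublevel_filtration r' t = sublevel_filtration r (\<psi> t)" for t
      using le_\<psi> by (auto simp: sublevel_filtration_def)
    fix i I t assume I: "I \<in># D i"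
    note bar = sublevel_bar[OF D nonneg I]
    have "Inf I \<in> bounded_endpoints D"
      using I bar(1) by (auto simp: bounded_endpoints_def interval_bounded_endpoints_def)
    then have "Inf I \<le> t \<longleftrightarrow> Inf I \<le> \<psi> t" by (rule endpoint)
    moreover have "t < Sup I \<longleftrightarrow> \<psi> t < Sup I" if "bdd_above I"
    proof -
      have "Sup I \<in> bounded_endpoints D"
        using I that by (auto simp: bounded_endpoints_def interval_bounded_endpoints_def)
      from endpoint[OF this, of t] show ?thesis by linarith
    qed
    ultimately show "t \<in> I \<longleftrightarrow> \<psi> t \<in> I"
      by (auto simp: bar(4)[of t] bar(4)[of "\<psi> t"])
  qed
qed


section \<open>Fibers over a generic cloud\<close>

lemma continuous_on_UNIV_imp_tendsto_nhds:
  fixes f :: "'a::t2_space \<Rightarrow> 'b::topological_space"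
  assumes "continuous_on UNIV f" shows "(f \<longlongrightarrow> f P) (nhds P)"
proof -
  have "isCont f P" using assms by (simp add: continuous_on_eq_continuous_at)
  then show ?thesis unfolding isCont_def tendsto_at_iff_tendsto_nhds .
qed

lemma eventually_in_point_clouds:
  fixes P :: "real ^ 'd ^ 'n"
  assumes "P \<in> point_clouds"
  shows "eventually (\<lambda>Q. Q \<in> point_clouds) (nhds P)"
proof -
  have "eventually (\<lambda>Q. i \<noteq> j \<longrightarrow> Q $ i \<noteq> Q $ j) (nhds P)" for i j
  proof (cases "i = j")
    case False
    have "((\<lambda>Q. Q $ i - Q $ j) \<longlongrightarrow> P $ i - P $ j) (nhds P)"
      by (intro tendsto_intros filterlim_ident)
    moreover have "P $ i - P $ j \<noteq> 0" using assms False by (simp add: point_clouds_def)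
    ultimately have "eventually (\<lambda>Q. Q $ i - Q $ j \<noteq> 0) (nhds P)" by (rule tendsto_imp_eventually_ne)
    then show ?thesis by (rule eventually_mono) simp
  qed simp
  then show ?thesis unfolding point_clouds_def by (simp add: eventually_all_finite)
qed

lemma semialgebraic_dim_ge:
  assumes "contains_cube T m" and "T \<subseteq> S"
  shows "semialgebraic_dim S \<ge> ereal (real m)"
proof -
  from assms obtain B and f :: "'a \<Rightarrow> 'a" where "B \<subseteq> Basis" "m \<le> card B"
    and "semialgebraic_map_on (coordinate_cube B) f" "inj_on f (coordinate_cube B)" "f ` coordinate_cube B \<subseteq> S"
    unfolding contains_cube_def by blast
  then have "ereal (real (card B)) \<le> semialgebraic_dim S"
    unfolding semialgebraic_dim_def by (intro Sup_upper) blast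
  moreover have "ereal (real m) \<le> ereal (real (card B))" using \<open>m \<le> card B\<close> by simp
  ultimately show ?thesis by (rule order_trans[rotated])
qed

text \<open>
  The properties shared by the two radii. The set \<open>H\<close> lists the possible values of the squared radii as pairs of
  numerator and denominator; which of them is attained may vary with \<open>P\<close>.
\<close>

definition rational_radius ::
  "(real ^ 'd ^ 'n \<Rightarrow> 'n set \<Rightarrow> real) \<Rightarrow> ((real ^ 'd ^ 'n \<Rightarrow> real) \<times> (real ^ 'd ^ 'n \<Rightarrow> real)) set \<Rightarrow> bool" where
  "rational_radius \<rho> H \<longleftrightarrow>
     finite H \<and> (\<forall>h\<in>H. real_polynomial_function (fst h) \<and> real_polynomial_function (snd h)) \<and>
     (\<forall>\<sigma>. \<sigma> \<noteq> {} \<longrightarrow> continuous_on UNIV (\<lambda>P. \<rho> P \<sigma>)) \<and>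
     (\<forall>P \<sigma>. \<sigma> \<noteq> {} \<longrightarrow> 0 \<le> \<rho> P \<sigma>) \<and>
     (\<forall>P v. \<rho> P {v} = 0) \<and>
     (\<forall>P\<in>point_clouds. \<forall>\<sigma>. card \<sigma> = 2 \<longrightarrow> 0 < \<rho> P \<sigma>) \<and>
     (\<forall>P\<in>point_clouds. \<forall>\<sigma>. \<sigma> \<noteq> {} \<longrightarrow> (\<exists>h\<in>H. snd h P \<noteq> 0 \<and> (\<rho> P \<sigma>)\<^sup>2 = ratio h P))"

text \<open>
  The denominators, and the numerators of all differences of two of the rational functions.
\<close>

definition radius_polynomials :: "(('a \<Rightarrow> real) \<times> ('a \<Rightarrow> real)) set \<Rightarrow> ('a \<Rightarrow> real) set" where
  "radius_polynomials H = snd ` H \<union> (\<lambda>(h, h'). (\<lambda>x. fst h x * snd h' x - fst h' x * snd h x)) ` (H \<times> H)"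

text \<open>
  A squared radius is continuous and has its values among those of finitely many rational functions. The
  functions that differ from it at \<open>P\<close> still do so nearby, and those that agree with it at \<open>P\<close> agree with each
  other everywhere, because \<open>P\<close> is generic. This also preserves ties between radii, while strict
  inequalities persist by continuity.
\<close>

lemma generic_radii_locally_rational:
  fixes P :: "real ^ 'd ^ 'n"
  assumes \<rho>: "rational_radius \<rho> H" and P: "P \<in> point_clouds"
    and generic: "generic_for (radius_polynomials H) P"
  obtains U j where "open U" "P \<in> U" "U \<subseteq> point_clouds"
    "\<And>\<sigma>. \<sigma> \<noteq> {} \<Longrightarrow> j \<sigma> \<in> H \<and> snd (j \<sigma>) P \<noteq> 0"
    "\<And>\<sigma> Q. \<lbrakk>\<sigma> \<noteq> {}; Q \<in> U\<rbrakk> \<Longrightarrow> (\<rho> Q \<sigma>)\<^sup>2 = ratio (j \<sigma>) Q"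
    "\<And>\<sigma> \<tau> Q. \<lbrakk>\<sigma> \<noteq> {}; \<tau> \<noteq> {}; Q \<in> U\<rbrakk> \<Longrightarrow> \<rho> P \<sigma> \<le> \<rho> P \<tau> \<longleftrightarrow> \<rho> Q \<sigma> \<le> \<rho> Q \<tau>"
proof -
  define H0 where "H0 = {h\<in>H. \<exists>x. snd h x \<noteq> 0}"
  have "finite H0" using \<rho> by (simp add: rational_radius_def H0_def)
  have cont: "\<And>\<sigma>. \<sigma> \<noteq> {} \<Longrightarrow> continuous_on UNIV (\<lambda>P. \<rho> P \<sigma>)"
    and nonneg: "\<And>P \<sigma>. \<sigma> \<noteq> {} \<Longrightarrow> 0 \<le> \<rho> P \<sigma>"
    using \<rho> by (simp_all add: rational_radius_def)
  have rational: "\<exists>h\<in>H0. snd h Q \<noteq> 0 \<and> (\<rho> Q \<sigma>)\<^sup>2 = ratio h Q" if "Q \<in> point_clouds" "\<sigma> \<noteq> {}" for Q \<sigma>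
  proof -
    have "\<exists>h\<in>H. snd h Q \<noteq> 0 \<and> (\<rho> Q \<sigma>)\<^sup>2 = ratio h Q"
      using \<rho> that by (simp add: rational_radius_def)
    then show ?thesis unfolding H0_def by blast
  qed
  have nz: "snd h P \<noteq> 0" if "h \<in> H0" for h
    using generic that unfolding generic_for_def radius_polynomials_def H0_def by blast
  have agree: "ratio h Q = ratio h' Q"
    if "h \<in> H0" "h' \<in> H0" "ratio h P = ratio h' P" "snd h Q \<noteq> 0" "snd h' Q \<noteq> 0" for h h' Q
  proof -
    define f where "f = (\<lambda>x. fst h x * snd h' x - fst h' x * snd h x)"
    have "f \<in> radius_polynomials H"
      using that(1,2) by (force simp: radius_polynomials_def H0_def f_def)
    moreover have "f P = 0" using nz that(1-3) by (simp add: f_def field_simps)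
    ultimately have "f Q = 0" using generic unfolding generic_for_def by blast
    then show ?thesis using that(4,5) by (simp add: f_def field_simps)
  qed
  have "\<forall>\<sigma>. \<exists>h. \<sigma> \<noteq> {} \<longrightarrow> h \<in> H0 \<and> (\<rho> P \<sigma>)\<^sup>2 = ratio h P"
    using rational[OF P] by blast
  then obtain j where "\<forall>\<sigma>. \<sigma> \<noteq> {} \<longrightarrow> j \<sigma> \<in> H0 \<and> (\<rho> P \<sigma>)\<^sup>2 = ratio (j \<sigma>) P" by metis
  then have j: "j \<sigma> \<in> H0" and j_eq: "(\<rho> P \<sigma>)\<^sup>2 = ratio (j \<sigma>) P" if "\<sigma> \<noteq> {}" for \<sigma>
    using that by blast+
  have poly_tendsto: "(q \<longlongrightarrow> q P) (nhds P)" if "real_polynomial_function q" for q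
    using that by (intro continuous_on_UNIV_imp_tendsto_nhds differentiable_imp_continuous_on differentiable_on_real_polynomial_function)
  have snd_tendsto: "(snd h \<longlongrightarrow> snd h P) (nhds P)" if "h \<in> H0" for h
    using \<rho> that by (intro poly_tendsto) (auto simp: rational_radius_def H0_def)
  have ratio_tendsto: "(ratio h \<longlongrightarrow> ratio h P) (nhds P)" if "h \<in> H0" for h
    using \<rho> that nz[OF that] by (intro tendsto_divide snd_tendsto poly_tendsto)
      (auto simp: rational_radius_def H0_def)
  have \<rho>_tendsto: "((\<lambda>Q. \<rho> Q \<sigma>) \<longlongrightarrow> \<rho> P \<sigma>) (nhds P)" if "\<sigma> \<noteq> {}" for \<sigma>
    using continuous_on_UNIV_imp_tendsto_nhds[OF cont[OF that]] .
  have ev_nz: "eventually (\<lambda>Q. \<forall>h\<in>H0. snd h Q \<noteq> 0) (nhds P)"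
    using \<open>finite H0\<close> by (intro eventually_ball_finite ballI tendsto_imp_eventually_ne[OF snd_tendsto nz])
  have ev_ne: "eventually (\<lambda>Q. \<forall>\<sigma>. \<forall>h\<in>H0. \<sigma> \<noteq> {} \<longrightarrow> ratio h P \<noteq> (\<rho> P \<sigma>)\<^sup>2 \<longrightarrow> ratio h Q \<noteq> (\<rho> Q \<sigma>)\<^sup>2) (nhds P)"
  proof (intro eventually_all_finite eventually_ball_finite \<open>finite H0\<close> ballI)
    fix \<sigma> h assume "h \<in> H0"
    show "eventually (\<lambda>Q. \<sigma> \<noteq> {} \<longrightarrow> ratio h P \<noteq> (\<rho> P \<sigma>)\<^sup>2 \<longrightarrow> ratio h Q \<noteq> (\<rho> Q \<sigma>)\<^sup>2) (nhds P)"
    proof (cases "\<sigma> \<noteq> {} \<and> ratio h P \<noteq> (\<rho> P \<sigma>)\<^sup>2")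
      case True
      have "((\<lambda>Q. ratio h Q - (\<rho> Q \<sigma>)\<^sup>2) \<longlongrightarrow> ratio h P - (\<rho> P \<sigma>)\<^sup>2) (nhds P)"
        using True \<open>h \<in> H0\<close> by (intro tendsto_diff tendsto_power ratio_tendsto \<rho>_tendsto) auto
      then have "eventually (\<lambda>Q. ratio h Q - (\<rho> Q \<sigma>)\<^sup>2 \<noteq> 0) (nhds P)"
        using True by (intro tendsto_imp_eventually_ne) auto
      then show ?thesis by (rule eventually_mono) simp
    next
      case False
      then show ?thesis by (intro always_eventually allI) blast
    qed
  qed
  have ev_less: "eventually (\<lambda>Q. \<forall>\<sigma> \<tau>. \<sigma> \<noteq> {} \<longrightarrow> \<tau> \<noteq> {} \<longrightarrow> \<rho> P \<sigma> < \<rho> P \<tau> \<longrightarrow> \<rho> Q \<sigma> < \<rho> Q \<tau>) (nhds P)"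
  proof (intro eventually_all_finite)
    fix \<sigma> \<tau> :: "'n set"
    show "eventually (\<lambda>Q. \<sigma> \<noteq> {} \<longrightarrow> \<tau> \<noteq> {} \<longrightarrow> \<rho> P \<sigma> < \<rho> P \<tau> \<longrightarrow> \<rho> Q \<sigma> < \<rho> Q \<tau>) (nhds P)"
    proof (cases "\<sigma> \<noteq> {} \<and> \<tau> \<noteq> {} \<and> \<rho> P \<sigma> < \<rho> P \<tau>")
      case True
      then have "((\<lambda>Q. \<rho> Q \<tau> - \<rho> Q \<sigma>) \<longlongrightarrow> \<rho> P \<tau> - \<rho> P \<sigma>) (nhds P)"
        by (intro tendsto_diff \<rho>_tendsto) auto
      then have "eventually (\<lambda>Q. 0 < \<rho> Q \<tau> - \<rho> Q \<sigma>) (nhds P)"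
        using True by (intro order_tendstoD(1)) auto
      then show ?thesis by (rule eventually_mono) simp
    next
      case False
      then show ?thesis by (intro always_eventually allI) blast
    qed
  qed
  obtain U where U: "open U" "P \<in> U"
    and UQ: "\<forall>Q\<in>U. Q \<in> point_clouds \<and> (\<forall>h\<in>H0. snd h Q \<noteq> 0) \<and>
     (\<forall>\<sigma>. \<forall>h\<in>H0. \<sigma> \<noteq> {} \<longrightarrow> ratio h P \<noteq> (\<rho> P \<sigma>)\<^sup>2 \<longrightarrow> ratio h Q \<noteq> (\<rho> Q \<sigma>)\<^sup>2) \<and>
     (\<forall>\<sigma> \<tau>. \<sigma> \<noteq> {} \<longrightarrow> \<tau> \<noteq> {} \<longrightarrow> \<rho> P \<sigma> < \<rho> P \<tau> \<longrightarrow> \<rho> Q \<sigma> < \<rho> Q \<tau>)"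
    using eventually_conj[OF eventually_in_point_clouds[OF P] eventually_conj[OF ev_nz eventually_conj[OF ev_ne ev_less]]]
    unfolding eventually_nhds by (elim exE conjE)
  have U_cloud: "Q \<in> point_clouds" if "Q \<in> U" for Q using UQ that by simp
  have U_nz: "snd h Q \<noteq> 0" if "Q \<in> U" "h \<in> H0" for h Q using UQ that by simp
  have U_ne: "ratio h P = (\<rho> P \<sigma>)\<^sup>2" if "Q \<in> U" "h \<in> H0" "\<sigma> \<noteq> {}" "ratio h Q = (\<rho> Q \<sigma>)\<^sup>2" for h Q \<sigma>
  proof (rule ccontr)
    assume "ratio h P \<noteq> (\<rho> P \<sigma>)\<^sup>2"
    with UQ that(1-3) have "ratio h Q \<noteq> (\<rho> Q \<sigma>)\<^sup>2" by simp
    with that(4) show False by simp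
  qed
  have U_less: "\<rho> Q \<sigma> < \<rho> Q \<tau>" if "Q \<in> U" "\<sigma> \<noteq> {}" "\<tau> \<noteq> {}" "\<rho> P \<sigma> < \<rho> P \<tau>" for Q \<sigma> \<tau>
    using UQ that by simp
  have local: "(\<rho> Q \<sigma>)\<^sup>2 = ratio (j \<sigma>) Q" if "\<sigma> \<noteq> {}" "Q \<in> U" for \<sigma> Q
  proof -
    obtain h where h: "h \<in> H0" "(\<rho> Q \<sigma>)\<^sup>2 = ratio h Q" 
      using rational[OF U_cloud[OF \<open>Q \<in> U\<close>] \<open>\<sigma> \<noteq> {}\<close>] by (elim bexE conjE)
    have "ratio h P = (\<rho> P \<sigma>)\<^sup>2" by (rule U_ne[OF that(2) h(1) that(1) h(2)[symmetric]])
    then have "ratio h P = ratio (j \<sigma>) P" using j_eq[OF that(1)] by (rule trans)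
    from agree[OF h(1) j[OF that(1)] this U_nz[OF that(2) h(1)] U_nz[OF that(2) j[OF that(1)]]]
    have "ratio h Q = ratio (j \<sigma>) Q" .
    with h(2) show ?thesis by simp
  qed
  show thesis
  proof (rule that[OF U])
    show "U \<subseteq> point_clouds" using U_cloud by blast
    show "j \<sigma> \<in> H \<and> snd (j \<sigma>) P \<noteq> 0" if "\<sigma> \<noteq> {}" for \<sigma> using j[OF that] nz by (auto simp: H0_def)
    show "(\<rho> Q \<sigma>)\<^sup>2 = ratio (j \<sigma>) Q" if "\<sigma> \<noteq> {}" "Q \<in> U" for \<sigma> Q using local[OF that] .
    fix \<sigma> \<tau> :: "'n set" and Q assume \<sigma>\<tau>: "\<sigma> \<noteq> {}" "\<tau> \<noteq> {}" and Q: "Q \<in> U"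
    have less: "\<rho> P \<sigma> < \<rho> P \<tau> \<Longrightarrow> \<rho> Q \<sigma> < \<rho> Q \<tau>" "\<rho> P \<tau> < \<rho> P \<sigma> \<Longrightarrow> \<rho> Q \<tau> < \<rho> Q \<sigma>"
      using U_less[OF Q] \<sigma>\<tau> by simp_all
    have eq: "\<rho> Q \<sigma> = \<rho> Q \<tau>" if "\<rho> P \<sigma> = \<rho> P \<tau>"
    proof -
      have "ratio (j \<sigma>) P = ratio (j \<tau>) P" using j_eq[OF \<sigma>\<tau>(1)] j_eq[OF \<sigma>\<tau>(2)] that by metis
      from agree[OF j[OF \<sigma>\<tau>(1)] j[OF \<sigma>\<tau>(2)] this U_nz[OF Q j[OF \<sigma>\<tau>(1)]] U_nz[OF Q j[OF \<sigma>\<tau>(2)]]]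
      have "ratio (j \<sigma>) Q = ratio (j \<tau>) Q" .
      then have "(\<rho> Q \<sigma>)\<^sup>2 = (\<rho> Q \<tau>)\<^sup>2" using local \<sigma>\<tau> Q by simp
      then show ?thesis using nonneg \<sigma>\<tau> by (simp add: power2_eq_iff_nonneg)
    qed
    show "\<rho> P \<sigma> \<le> \<rho> P \<tau> \<longleftrightarrow> \<rho> Q \<sigma> \<le> \<rho> Q \<tau>"
      using less eq by (cases "\<rho> P \<sigma>" "\<rho> P \<tau>" rule: linorder_cases) auto
  qed
qed

text \<open>
  The level set on which the radii that occur as nonzero endpoints stay fixed is contained in the fiber. For each of these
  \<open>k - 1\<close> endpoints one simplex of that radius suffices, since ties persist.
\<close>

lemma ph_fiber_dim_generic:
  fixes \<rho> :: "real ^ 'd ^ 'n::{finite,linorder} \<Rightarrow> 'n::{finite,linorder} set \<Rightarrow> real"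
  assumes \<rho>: "rational_radius \<rho> H"
  shows "\<exists>A :: (real ^ 'd ^ 'n::{finite,linorder}) set. algebraic_set A \<and> A \<noteq> UNIV \<and>
    (\<forall>P \<in> point_clouds - A. \<forall>D k.
       has_persistent_homology TYPE('f::field) (sublevel_filtration (\<rho> P)) D \<and>
       card (bounded_endpoints D) = k \<longrightarrow>
       semialgebraic_dim (ph_fiber TYPE('f) (\<lambda>P. sublevel_filtration (\<rho> P)) D)
         \<ge> ereal (real CARD('n) * real CARD('d) - real k + 1))"
proof -
  have "finite H" and poly: "\<And>h. h \<in> H \<Longrightarrow> real_polynomial_function (fst h) \<and> real_polynomial_function (snd h)"
    and nonneg: "\<And>P \<sigma>. \<sigma> \<noteq> {} \<Longrightarrow> 0 \<le> \<rho> P \<sigma>" and vertex: "\<And>P v. \<rho> P {v} = 0"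
    and edge: "\<And>P \<sigma>. \<lbrakk>P \<in> point_clouds; card \<sigma> = 2\<rbrakk> \<Longrightarrow> 0 < \<rho> P \<sigma>"
    using \<rho> by (simp_all add: rational_radius_def)
  obtain F where "finite F" and F_poly: "\<And>p. p \<in> F \<Longrightarrow> real_polynomial_function p"
    and cube: "\<And>P J U. \<lbrakk>generic_for F P; J \<subseteq> H; \<And>h. h \<in> J \<Longrightarrow> snd h P \<noteq> 0; open U; P \<in> U\<rbrakk> \<Longrightarrow>
       contains_cube {Q \<in> U. \<forall>h\<in>J. snd h Q \<noteq> 0 \<and> ratio h Q = ratio h P} (DIM(real ^ 'd ^ 'n::{finite,linorder}) - card J)"
    using generic_level_set_contains_cube[OF \<open>finite H\<close> poly] by blast
  have "finite (F \<union> radius_polynomials H)"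
    using \<open>finite F\<close> \<open>finite H\<close> by (simp add: radius_polynomials_def)
  moreover have "real_polynomial_function p" if "p \<in> F \<union> radius_polynomials H" for p
    using that F_poly poly by (auto simp: radius_polynomials_def intro!: polynomial_intros)
  ultimately obtain A where A: "algebraic_set A" "A \<noteq> UNIV"
    and generic: "\<And>P. P \<notin> A \<Longrightarrow> generic_for (F \<union> radius_polynomials H) P"
    using generic_for_outside_algebraic_set[of "F \<union> radius_polynomials H"] by blast
  have "semialgebraic_dim (ph_fiber TYPE('f) (\<lambda>P. sublevel_filtration (\<rho> P)) D)
      \<ge> ereal (real CARD('n) * real CARD('d) - real (card (bounded_endpoints D)) + 1)"
    if P: "P \<in> point_clouds" "P \<notin> A"
      and D: "has_persistent_homology TYPE('f) (sublevel_filtration (\<rho> P)) D" for P D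
  proof -
    have generic_F: "generic_for F P" and generic_H: "generic_for (radius_polynomials H) P"
      using generic[OF P(2)] by (simp_all add: generic_for_def)
    obtain U j where U: "open U" "P \<in> U" "U \<subseteq> point_clouds"
      and j: "\<And>\<sigma>. \<sigma> \<noteq> {} \<Longrightarrow> j \<sigma> \<in> H \<and> snd (j \<sigma>) P \<noteq> 0"
      and local: "\<And>\<sigma> Q. \<lbrakk>\<sigma> \<noteq> {}; Q \<in> U\<rbrakk> \<Longrightarrow> (\<rho> Q \<sigma>)\<^sup>2 = ratio (j \<sigma>) Q"
      and order: "\<And>\<sigma> \<tau> Q. \<lbrakk>\<sigma> \<noteq> {}; \<tau> \<noteq> {}; Q \<in> U\<rbrakk> \<Longrightarrow> \<rho> P \<sigma> \<le> \<rho> P \<tau> \<longleftrightarrow> \<rho> Q \<sigma> \<le> \<rho> Q \<tau>"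
      by (rule generic_radii_locally_rational[OF \<rho> P(1) generic_H]) (rule that; assumption)
    define E where "E = bounded_endpoints D"
    have E_radii: "E \<subseteq> \<rho> P ` (- {{}})"
      unfolding E_def by (rule bounded_endpoints_subset_radii[OF D nonneg])
    then have "finite E" by (rule finite_subset) simp
    have "0 \<in> E"
      unfolding E_def by (rule zero_is_bounded_endpoint[OF D nonneg vertex edge[OF P(1)]])
    have "\<forall>e. \<exists>\<sigma>. e \<in> E \<longrightarrow> \<sigma> \<noteq> {} \<and> \<rho> P \<sigma> = e" using E_radii by blast
    then obtain s where s: "\<And>e. e \<in> E \<Longrightarrow> s e \<noteq> {} \<and> \<rho> P (s e) = e" by metis
    define J where "J = (\<lambda>e. j (s e)) ` (E - {0})"
    have "card J \<le> card (E - {0})" unfolding J_def using \<open>finite E\<close> by (intro card_image_le) simp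
    then have card_J: "card J + 1 \<le> card E"
      using card_Suc_Diff1[OF \<open>finite E\<close> \<open>0 \<in> E\<close>] by simp
    have "contains_cube {Q \<in> U. \<forall>h\<in>J. snd h Q \<noteq> 0 \<and> ratio h Q = ratio h P} (DIM(real ^ 'd ^ 'n::{finite,linorder}) - card J)"
      using j s U by (intro cube generic_F) (auto simp: J_def)
    moreover have "{Q \<in> U. \<forall>h\<in>J. snd h Q \<noteq> 0 \<and> ratio h Q = ratio h P} \<subseteq>
        ph_fiber TYPE('f) (\<lambda>P. sublevel_filtration (\<rho> P)) D"
    proof
      fix Q assume "Q \<in> {Q \<in> U. \<forall>h\<in>J. snd h Q \<noteq> 0 \<and> ratio h Q = ratio h P}"
      then have Q: "Q \<in> U" and level: "\<And>h. h \<in> J \<Longrightarrow> ratio h Q = ratio h P" by auto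
      have same: "\<rho> Q \<sigma> = \<rho> Q \<tau>" if "\<sigma> \<noteq> {}" "\<tau> \<noteq> {}" "\<rho> P \<sigma> = \<rho> P \<tau>" for \<sigma> \<tau>
        using order[OF that(1,2) Q] order[OF that(2,1) Q] that(3) by simp
      \<comment> \<open>For the endpoint \<open>0\<close> compare with a vertex, which has radius \<open>0\<close> in every cloud.\<close>
      have "\<rho> Q \<sigma> = \<rho> P \<sigma>" if "\<sigma> \<noteq> {}" "\<rho> P \<sigma> \<in> E" for \<sigma>
      proof (cases "\<rho> P \<sigma> = 0")
        case True
        then show ?thesis using same[of \<sigma> "{undefined}"] that(1) vertex by simp
      next
        case False
        let ?\<tau> = "s (\<rho> P \<sigma>)"
        have \<tau>: "?\<tau> \<noteq> {}" "\<rho> P ?\<tau> = \<rho> P \<sigma>" using s[OF that(2)] by auto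
        have "j ?\<tau> \<in> J" using False that(2) by (auto simp: J_def)
        then have "(\<rho> Q ?\<tau>)\<^sup>2 = (\<rho> P ?\<tau>)\<^sup>2"
          using level local[OF \<tau>(1) Q] local[OF \<tau>(1) U(2)] by simp
        then have "\<rho> Q ?\<tau> = \<rho> P ?\<tau>" using nonneg[OF \<tau>(1)] by (simp add: power2_eq_iff_nonneg)
        then show ?thesis using same[OF that(1) \<tau>(1)] \<tau>(2) by simp
      qed
      then have "has_persistent_homology TYPE('f) (sublevel_filtration (\<rho> Q)) D"
        using order[OF _ _ Q] by (intro has_persistent_homology_same_order[OF D nonneg]) (auto simp: E_def)
      then show "Q \<in> ph_fiber TYPE('f) (\<lambda>P. sublevel_filtration (\<rho> P)) D"
        using Q U(3) by (auto simp: ph_fiber_def)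
    qed
    ultimately have "ereal (real (DIM(real ^ 'd ^ 'n::{finite,linorder}) - card J)) \<le>
        semialgebraic_dim (ph_fiber TYPE('f) (\<lambda>P. sublevel_filtration (\<rho> P)) D)"
      by (rule semialgebraic_dim_ge)
    moreover have "real CARD('n) * real CARD('d) - real (card E) + 1 \<le> real (DIM(real ^ 'd ^ 'n::{finite,linorder}) - card J)"
    proof -
      have "real (DIM(real ^ 'd ^ 'n::{finite,linorder})) = real CARD('n) * real CARD('d)" by simp
      then show ?thesis using card_J by linarith
    qed
    ultimately show ?thesis unfolding E_def by (meson ereal_less_eq(3) order_trans)
  qed
  with A show ?thesis by blast
qed


section \<open>Minimal enclosing balls\<close>

definition enclosing_radii :: "('i \<Rightarrow> 'a::euclidean_space) \<Rightarrow> 'i set \<Rightarrow> real set" where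
  "enclosing_radii p S = {r. \<exists>q. \<forall>i\<in>S. norm (p i - q) \<le> r}"

definition min_enclosing_radius :: "('i \<Rightarrow> 'a::euclidean_space) \<Rightarrow> 'i set \<Rightarrow> real" where
  "min_enclosing_radius p S = Inf (enclosing_radii p S)"

lemma enclosing_radii_nonneg: "S \<noteq> {} \<Longrightarrow> r \<in> enclosing_radii p S \<Longrightarrow> 0 \<le> r"
  unfolding enclosing_radii_def by simp (metis all_not_in_conv norm_ge_zero order_trans)

lemma enclosing_radii_bdd_below: "S \<noteq> {} \<Longrightarrow> bdd_below (enclosing_radii p S)"
  using enclosing_radii_nonneg by (metis bdd_belowI)

lemma enclosing_radii_nonempty:
  assumes "finite S" shows "enclosing_radii p S \<noteq> {}"
proof -
  have "norm (p i - 0) \<le> (\<Sum>i\<in>S. norm (p i))" if "i \<in> S" for i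
    using member_le_sum[of i S "\<lambda>i. norm (p i)"] that assms by simp
  then have "(\<Sum>i\<in>S. norm (p i)) \<in> enclosing_radii p S" unfolding enclosing_radii_def by blast
  then show ?thesis by blast
qed

text \<open>
  A centre is a common point of the compact sets of centres for slightly larger radii.
\<close>

lemma min_enclosing_radius_attained:
  assumes "finite S" and "S \<noteq> {}"
  shows "min_enclosing_radius p S \<in> enclosing_radii p S"
proof -
  define \<rho> where "\<rho> = min_enclosing_radius p S"
  define C where "C n = (\<Inter>i\<in>S. cball (p i) (\<rho> + 1 / Suc n))" for n
  have "\<Inter> (range C) \<noteq> {}"
  proof (rule compact_nest)
    show "compact (C n)" for n
    proof -
      obtain i where "i \<in> S" using assms(2) by blast
      then have "bounded (C n)"
        unfolding C_def by (intro bounded_subset[OF bounded_cball]) blast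
      moreover have "closed (C n)" unfolding C_def by (intro closed_INT ballI closed_cball)
      ultimately show ?thesis by (simp add: compact_eq_bounded_closed)
    qed
    show "C n \<noteq> {}" for n
    proof -
      obtain r where "r \<in> enclosing_radii p S" "r < \<rho> + 1 / Suc n"
        using cInf_lessD[OF enclosing_radii_nonempty[OF assms(1)], of p "\<rho> + 1 / Suc n"]
        by (auto simp: \<rho>_def min_enclosing_radius_def)
      then obtain q where "\<forall>i\<in>S. norm (p i - q) < \<rho> + 1 / Suc n"
        unfolding enclosing_radii_def by (auto dest: le_less_trans)
      then have "q \<in> C n" by (simp add: C_def dist_norm less_imp_le)
      then show ?thesis by blast
    qed
    show "C n \<subseteq> C m" if "m \<le> n" for m n
    proof -
      have "1 / real (Suc n) \<le> 1 / real (Suc m)" using that by (simp add: field_simps)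
      then show ?thesis by (fastforce simp: C_def)
    qed
  qed
  then obtain q where q: "\<And>n. q \<in> C n" by blast
  have "norm (p i - q) \<le> \<rho>" if "i \<in> S" for i
  proof (rule field_le_epsilon)
    fix e :: real assume "e > 0"
    then obtain n where "1 / real (Suc n) < e" using nat_approx_posE by metis
    moreover have "norm (p i - q) \<le> \<rho> + 1 / Suc n" using q[of n] that by (simp add: C_def dist_norm)
    ultimately show "norm (p i - q) \<le> \<rho> + e" by simp
  qed
  then show ?thesis unfolding enclosing_radii_def \<rho>_def by blast
qed

lemma enclosing_radii_eq:
  assumes "finite S" and "S \<noteq> {}"
  shows "r \<in> enclosing_radii p S \<longleftrightarrow> min_enclosing_radius p S \<le> r"
proof
  assume "r \<in> enclosing_radii p S"
  then show "min_enclosing_radius p S \<le> r"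
    unfolding min_enclosing_radius_def using enclosing_radii_bdd_below[OF assms(2)] by (intro cInf_lower)
next
  assume "min_enclosing_radius p S \<le> r"
  moreover obtain q where "\<forall>i\<in>S. norm (p i - q) \<le> min_enclosing_radius p S"
    using min_enclosing_radius_attained[OF assms, of p] by (auto simp: enclosing_radii_def)
  ultimately show "r \<in> enclosing_radii p S"
    unfolding enclosing_radii_def by (auto intro: order_trans)
qed

lemma min_enclosing_radius_lipschitz:
  assumes S: "finite S" "S \<noteq> {}" and close: "\<And>i. i \<in> S \<Longrightarrow> norm (p i - p' i) \<le> e"
  shows "min_enclosing_radius p' S \<le> min_enclosing_radius p S + e"
proof -
  obtain q where q: "\<And>i. i \<in> S \<Longrightarrow> norm (p i - q) \<le> min_enclosing_radius p S"
    using min_enclosing_radius_attained[OF S, of p] by (auto simp: enclosing_radii_def)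
  have "norm (p' i - q) \<le> min_enclosing_radius p S + e" if "i \<in> S" for i
    using q[OF that] close[OF that] norm_triangle_ineq[of "p' i - p i" "p i - q"]
    by (simp add: norm_minus_commute)
  then show ?thesis
    unfolding enclosing_radii_eq[OF S, symmetric] enclosing_radii_def by blast
qed

text \<open>
  Otherwise a hyperplane separates \<open>q\<close> from the contact points; moving \<open>q\<close> slightly towards that hyperplane
  decreases the distance to all contact points, and a smaller ball suffices.
\<close>

lemma min_enclosing_center_in_hull_of_contact_points:
  assumes S: "finite S" "S \<noteq> {}" and q: "\<And>i. i \<in> S \<Longrightarrow> norm (p i - q) \<le> min_enclosing_radius p S"
  shows "q \<in> convex hull (p ` {i\<in>S. norm (p i - q) = min_enclosing_radius p S})"
proof (rule ccontr)
  define \<rho> where "\<rho> = min_enclosing_radius p S"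
  define T where "T = {i\<in>S. norm (p i - q) = \<rho>}"
  assume "q \<notin> convex hull (p ` {i\<in>S. norm (p i - q) = min_enclosing_radius p S})"
  then have "q \<notin> convex hull (p ` T)" by (simp add: T_def \<rho>_def)
  moreover have "closed (convex hull (p ` T))"
    using S(1) by (intro compact_imp_closed finite_imp_compact_convex_hull) (simp add: T_def)
  ultimately obtain a b where "a \<bullet> q < b" "\<forall>x\<in>convex hull (p ` T). a \<bullet> x > b"
    using separating_hyperplane_closed_point[of "convex hull (p ` T)" q] by auto
  then have a: "a \<bullet> (p i - q) > 0" if "i \<in> T" for i
    using that hull_inc[of "p i" "p ` T" convex] by (force simp: inner_diff_right)
  have "eventually (\<lambda>t. norm (p i - (q + t *\<^sub>R a)) < \<rho>) (at_right 0)" if "i \<in> S" for i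
  proof (cases "i \<in> T")
    case True
    \<comment> \<open>The squared distance changes by \<open>t\<^sup>2 (a \<bullet> a) - 2 t (a \<bullet> (p i - q))\<close>, which is negative for \<open>0 < t < s\<close>; the \<open>+ 1\<close> avoids a vanishing denominator.\<close>
    define s where "s = 2 * (a \<bullet> (p i - q)) / (a \<bullet> a + 1)"
    have den: "a \<bullet> a + 1 > 0" by (simp add: add_nonneg_pos)
    have "s > 0" using a[OF True] den by (simp add: s_def)
    then have "eventually (\<lambda>t. 0 < t \<and> t < s) (at_right 0)"
      using eventually_at_right_less eventually_at_right_field[of _ 0] by (auto intro!: exI[of _ s])
    then show ?thesis
    proof (rule eventually_mono)
      fix t assume t: "0 < t \<and> t < s"
      have "t * (a \<bullet> a) \<le> t * (a \<bullet> a + 1)" using t by simp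
      also have "\<dots> < s * (a \<bullet> a + 1)" using t den by (intro mult_strict_right_mono) auto
      also have "\<dots> = 2 * (a \<bullet> (p i - q))" using den by (simp add: s_def)
      finally have "t * (t * (a \<bullet> a)) < t * (2 * (a \<bullet> (p i - q)))" using t by simp
      moreover have "(norm (p i - (q + t *\<^sub>R a)))\<^sup>2 = (norm (p i - q))\<^sup>2 + t * (t * (a \<bullet> a)) - t * (2 * (a \<bullet> (p i - q)))"
        by (simp add: power2_norm_eq_inner algebra_simps inner_commute)
      ultimately have "(norm (p i - (q + t *\<^sub>R a)))\<^sup>2 < (norm (p i - q))\<^sup>2" by simp
      then show "norm (p i - (q + t *\<^sub>R a)) < \<rho>"
        using True power2_less_imp_less[OF _ norm_ge_zero] by (force simp: T_def)
    qed
  next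
    case False
    then have "norm (p i - q) < \<rho>" using q[OF that] that by (simp add: T_def \<rho>_def less_le)
    moreover have "((\<lambda>t. norm (p i - (q + t *\<^sub>R a))) \<longlongrightarrow> norm (p i - (q + 0 *\<^sub>R a))) (at_right 0)"
      by (intro tendsto_intros)
    ultimately show ?thesis by (intro order_tendstoD(2)) simp_all
  qed
  then have "eventually (\<lambda>t. \<forall>i\<in>S. norm (p i - (q + t *\<^sub>R a)) < \<rho>) (at_right 0)"
    using S(1) by (intro eventually_ball_finite) auto
  then obtain t where t: "\<forall>i\<in>S. norm (p i - (q + t *\<^sub>R a)) < \<rho>"
    using eventually_happens'[OF trivial_limit_at_right_real] by blast
  define m where "m = Max ((\<lambda>i. norm (p i - (q + t *\<^sub>R a))) ` S)"
  have "m < \<rho>" unfolding m_def using S t by simp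
  moreover have "norm (p i - (q + t *\<^sub>R a)) \<le> m" if "i \<in> S" for i
    unfolding m_def using that S(1) by simp
  then have "m \<in> enclosing_radii p S" unfolding enclosing_radii_def by blast
  ultimately show False unfolding enclosing_radii_eq[OF S] \<rho>_def by simp
qed

text \<open>
  A subset of least cardinality works, by the form of Caratheodory's theorem that bounds the cardinality by the
  affine dimension.
\<close>

lemma convex_hull_affinely_independent_subset:
  fixes S :: "'a::euclidean_space set"
  assumes "x \<in> convex hull S"
  obtains T where "T \<subseteq> S" "\<not> affine_dependent T" "x \<in> convex hull T"
proof -
  have "\<exists>n T. finite T \<and> T \<subseteq> S \<and> x \<in> convex hull T \<and> card T = n"
    using assms unfolding caratheodory[of S] by blast
  from exists_least_iff[THEN iffD1, OF this] obtain n T where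
    T: "finite T" "T \<subseteq> S" "x \<in> convex hull T" "card T = n"
    and least: "\<forall>m<n. \<not> (\<exists>T. finite T \<and> T \<subseteq> S \<and> x \<in> convex hull T \<and> card T = m)" by blast
  obtain T' where T': "finite T'" "T' \<subseteq> T" "int (card T') \<le> aff_dim T + 1" "x \<in> convex hull T'"
    using T(3) unfolding caratheodory_aff_dim[of T] by blast
  have "\<not> card T' < card T" using least T(2,4) T' by blast
  then have "aff_dim T = int (card T) - 1"
    using T'(3) aff_dim_le_card[OF T(1)] by linarith
  then show thesis
    using that[OF T(2)] T(1,3) affine_independent_iff_card[of T] by blast
qed

text \<open>
  The vertex \<open>v0\<close> is the origin of the affine coordinates: \<open>c\<close> is the circumcentre of the simplex \<open>insert v0 K\<close>, and
  \<open>h\<close> gives its squared circumradius whenever the simplex is nondegenerate.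
\<close>

definition computes_circumradius ::
  "'n::finite \<Rightarrow> 'n set \<Rightarrow> (real ^ 'd ^ 'n \<Rightarrow> real) \<times> (real ^ 'd ^ 'n \<Rightarrow> real) \<Rightarrow> bool" where
  "computes_circumradius v0 K h \<longleftrightarrow>
     real_polynomial_function (fst h) \<and> real_polynomial_function (snd h) \<and>
     (\<forall>P c. independent_family (\<lambda>j. P $ j - P $ v0) K \<and>
        c - P $ v0 \<in> span ((\<lambda>j. P $ j - P $ v0) ` K) \<and>
        (\<forall>j\<in>K. norm (P $ j - c) = norm (P $ v0 - c)) \<longrightarrow>
        snd h P \<noteq> 0 \<and> (norm (P $ v0 - c))\<^sup>2 = ratio h P)"

text \<open>
  Relative to \<open>v0\<close>, the circumcentre \<open>x\<close> is the solution in the span of the edge vectors \<open>v\<^sub>j\<close> of the linear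
  system \<open>v\<^sub>j \<bullet> x = (v\<^sub>j \<bullet> v\<^sub>j) / 2\<close>.
\<close>

lemma circumradius_rational:
  fixes v0 :: "'n::finite" and K :: "'n::finite set"
  shows "\<exists>h :: (real ^ 'd ^ 'n \<Rightarrow> real) \<times> (real ^ 'd ^ 'n \<Rightarrow> real). computes_circumradius v0 K h"
proof -
  define V where "V j P = P $ j - P $ v0" for j and P :: "real ^ 'd ^ 'n"
  have V: "polynomial_function (V j)" for j
    unfolding V_def by (intro polynomial_function_diff polynomial_function_bounded_linear bounded_linear_vec_nth)
  define b where "b j P = (V j P \<bullet> V j P) / 2" for j P
  have b: "real_polynomial_function (b j)" for j
    unfolding b_def by (intro polynomial_intros V)
  obtain p where p: "real_polynomial_function p"
    and p_iff: "\<forall>P. p P \<noteq> 0 \<longleftrightarrow> independent_family (\<lambda>j. V j P) K"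
    and solve: "\<forall>b. (\<forall>j\<in>K. real_polynomial_function (b j)) \<longrightarrow>
      (\<exists>W. polynomial_function W \<and> (\<forall>P. p P \<noteq> 0 \<longrightarrow>
         W P \<in> span ((\<lambda>j. V j P) ` K) \<and> (\<forall>j\<in>K. V j P \<bullet> W P = p P * b j P)))"
    using polynomial_cramer_rule[of K V] V by auto
  from solve b obtain W where W: "polynomial_function W"
    and W_solves: "\<forall>P. p P \<noteq> 0 \<longrightarrow>
         W P \<in> span ((\<lambda>j. V j P) ` K) \<and> (\<forall>j\<in>K. V j P \<bullet> W P = p P * b j P)" by blast
  have main: "p P * p P \<noteq> 0 \<and> (norm (P $ v0 - c))\<^sup>2 = (W P \<bullet> W P) / (p P * p P)"
    if indep: "independent_family (\<lambda>j. P $ j - P $ v0) K"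
      and span: "c - P $ v0 \<in> span ((\<lambda>j. P $ j - P $ v0) ` K)"
      and equidistant: "\<forall>j\<in>K. norm (P $ j - c) = norm (P $ v0 - c)" for P c
  proof -
    define x where "x = c - P $ v0"
    have nz: "p P \<noteq> 0" using p_iff indep by (simp add: V_def)
    define y where "y = (1 / p P) *\<^sub>R W P - x"
    have y_span: "y \<in> span ((\<lambda>j. V j P) ` K)"
      unfolding y_def using W_solves nz span by (intro span_diff span_scale) (auto simp: V_def x_def)
    have "V j P \<bullet> y = 0" if "j \<in> K" for j
    proof -
      have "(norm (V j P - x))\<^sup>2 = (norm x)\<^sup>2"
        using equidistant that by (simp add: V_def x_def norm_minus_commute)
      then have "V j P \<bullet> x = b j P"
        by (simp add: power2_norm_eq_inner b_def inner_diff_left inner_diff_right inner_commute)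
      moreover have "V j P \<bullet> W P = p P * b j P" using W_solves nz that by blast
      ultimately show ?thesis using nz by (simp add: y_def inner_diff_right)
    qed
    then have "z \<bullet> y = 0" if "z \<in> (\<lambda>j. V j P) ` K" for z using that by auto
    then have "y \<bullet> y = 0" using y_span by (rule inner_span_eq_zero)
    then have "x = (1 / p P) *\<^sub>R W P" by (simp add: y_def)
    then have "x \<bullet> x = (W P \<bullet> W P) / (p P * p P)" by simp
    moreover have "(norm (P $ v0 - c))\<^sup>2 = x \<bullet> x"
      by (simp add: x_def power2_norm_eq_inner[symmetric] norm_minus_commute)
    ultimately show ?thesis using nz by simp
  qed
  have "real_polynomial_function (\<lambda>P. W P \<bullet> W P)" "real_polynomial_function (\<lambda>P. p P * p P)"
    by (intro polynomial_intros W p)+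
  with main show ?thesis
    unfolding computes_circumradius_def
    by (intro exI[of _ "(\<lambda>P. W P \<bullet> W P, \<lambda>P. p P * p P)"]) (simp only: fst_conv snd_conv, blast)
qed

text \<open>
  The centre of the minimal enclosing ball is in the convex hull of the contact points, hence of
  affinely independent ones, and it is equidistant from these.
\<close>

lemma min_enclosing_radius_is_circumradius:
  fixes P :: "real ^ 'd ^ 'n"
  assumes P: "P \<in> point_clouds" and \<sigma>: "\<sigma> \<noteq> {}"
  obtains v0 K c where "independent_family (\<lambda>j. P $ j - P $ v0) K"
    "c - P $ v0 \<in> span ((\<lambda>j. P $ j - P $ v0) ` K)"
    "\<forall>j\<in>K. norm (P $ j - c) = norm (P $ v0 - c)"
    "norm (P $ v0 - c) = min_enclosing_radius (\<lambda>i. P $ i) \<sigma>"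
proof -
  define \<rho> where "\<rho> = min_enclosing_radius (\<lambda>i. P $ i) \<sigma>"
  have fin: "finite \<sigma>" by simp
  obtain c where c: "\<And>i. i \<in> \<sigma> \<Longrightarrow> norm (P $ i - c) \<le> \<rho>"
    using min_enclosing_radius_attained[OF fin \<sigma>, of "\<lambda>i. P $ i"]
    by (auto simp: enclosing_radii_def \<rho>_def)
  define S where "S = {i\<in>\<sigma>. norm (P $ i - c) = \<rho>}"
  have "c \<in> convex hull ((\<lambda>i. P $ i) ` S)"
    unfolding S_def \<rho>_def
    by (rule min_enclosing_center_in_hull_of_contact_points[OF fin \<sigma>]) (use c in \<open>simp add: \<rho>_def\<close>)
  then obtain T where T: "T \<subseteq> (\<lambda>i. P $ i) ` S" "\<not> affine_dependent T" "c \<in> convex hull T"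
    by (rule convex_hull_affinely_independent_subset)
  obtain L where L: "L \<subseteq> S" "T = (\<lambda>i. P $ i) ` L" using T(1) by (auto simp: subset_image_iff)
  have "L \<noteq> {}" using T(3) L(2) by auto
  then obtain v0 where v0: "v0 \<in> L" by blast
  define K where "K = L - {v0}"
  have inj: "inj ((\<lambda>i. P $ i))" using P by (auto simp: point_clouds_def inj_on_def)
  have T_eq: "T = insert (P $ v0) ((\<lambda>i. P $ i) ` K)" using L(2) v0 by (auto simp: K_def)
  have notin: "P $ v0 \<notin> (\<lambda>i. P $ i) ` K"
    using inj by (auto simp: K_def inj_eq)
  have contact: "norm (P $ j - c) = \<rho>" if "j \<in> L" for j using that L(1) by (auto simp: S_def)
  show thesis
  proof (rule that[of v0 K c])
    have "inj_on (\<lambda>j. P $ j - P $ v0) K" using inj by (auto simp: inj_on_def)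
    moreover have "(\<lambda>x. - (P $ v0) + x) ` (\<lambda>i. P $ i) ` K = (\<lambda>j. P $ j - P $ v0) ` K"
      by (simp add: image_image)
    then have "independent ((\<lambda>j. P $ j - P $ v0) ` K)"
      using T(2) affine_dependent_iff_dependent[OF notin] by (simp add: T_eq)
    ultimately show "independent_family (\<lambda>j. P $ j - P $ v0) K" by blast
    have "c \<in> affine hull T" using T(3) convex_hull_subset_affine_hull by blast
    moreover have "{x - P $ v0 |x. x \<in> (\<lambda>i. P $ i) ` K} = (\<lambda>j. P $ j - P $ v0) ` K" by auto
    ultimately show "c - P $ v0 \<in> span ((\<lambda>j. P $ j - P $ v0) ` K)"
      unfolding T_eq affine_hull_insert_span[OF notin] by auto
    show "\<forall>j\<in>K. norm (P $ j - c) = norm (P $ v0 - c)"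
      using contact v0 by (simp add: K_def)
    show "norm (P $ v0 - c) = min_enclosing_radius (\<lambda>i. P $ i) \<sigma>"
      using contact[OF v0] by (simp add: \<rho>_def)
  qed
qed


section \<open>The Vietoris-Rips and Cech radii\<close>

lemma continuous_on_Max:
  fixes f :: "'i \<Rightarrow> 'a::topological_space \<Rightarrow> real"
  assumes "finite I" and "I \<noteq> {}" and "\<And>i. i \<in> I \<Longrightarrow> continuous_on S (f i)"
  shows "continuous_on S (\<lambda>x. Max ((\<lambda>i. f i x) ` I))"
  using assms
proof (induction I rule: finite_ne_induct)
  case (insert i I)
  then have "continuous_on S (\<lambda>x. max (f i x) (Max ((\<lambda>i. f i x) ` I)))"
    by (intro continuous_on_max) auto
  then show ?case using insert.hyps by simp
qed simp

definition half_diameter :: "real ^ 'd ^ 'n \<Rightarrow> 'n set \<Rightarrow> real" where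
  "half_diameter P \<sigma> = Max ((\<lambda>(i, j). norm (P $ i - P $ j) / 2) ` (\<sigma> \<times> \<sigma>))"

lemma rational_radius_half_diameter:
  "rational_radius (half_diameter :: real ^ 'd ^ 'n \<Rightarrow> 'n set \<Rightarrow> real)
     (range (\<lambda>(i, j). (\<lambda>P. (P $ i - P $ j) \<bullet> (P $ i - P $ j) / 4, \<lambda>_. 1)))"
  unfolding rational_radius_def
proof (intro conjI allI ballI impI)
  show "finite (range (\<lambda>(i, j). (\<lambda>P::real ^ 'd ^ 'n. (P $ i - P $ j) \<bullet> (P $ i - P $ j) / 4, \<lambda>_::real ^ 'd ^ 'n. 1::real)))"
    by simp
  fix h assume h: "h \<in> range (\<lambda>(i, j). (\<lambda>P::real ^ 'd ^ 'n. (P $ i - P $ j) \<bullet> (P $ i - P $ j) / 4, \<lambda>_::real ^ 'd ^ 'n. 1::real))"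
  have coord: "polynomial_function (\<lambda>P::real ^ 'd ^ 'n. P $ i)" for i
    by (intro polynomial_function_bounded_linear bounded_linear_vec_nth)
  show "real_polynomial_function (fst h)" "real_polynomial_function (snd h)"
    using h by (auto intro!: polynomial_intros coord)
next
  fix \<sigma> :: "'n set" assume "\<sigma> \<noteq> {}"
  then have "continuous_on UNIV (\<lambda>P::real ^ 'd ^ 'n. Max ((\<lambda>ij. norm (P $ fst ij - P $ snd ij) / 2) ` (\<sigma> \<times> \<sigma>)))"
    by (intro continuous_on_Max continuous_intros) auto
  then show "continuous_on UNIV (\<lambda>P::real ^ 'd ^ 'n. half_diameter P \<sigma>)"
    by (simp add: half_diameter_def case_prod_beta)
next
  fix P :: "real ^ 'd ^ 'n" and \<sigma> :: "'n set" assume "\<sigma> \<noteq> {}"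
  then obtain i where "i \<in> \<sigma>" by blast
  then have "norm (P $ i - P $ i) / 2 \<le> half_diameter P \<sigma>"
    unfolding half_diameter_def by (intro Max_ge) force+
  then show "0 \<le> half_diameter P \<sigma>" by simp
next
  fix P :: "real ^ 'd ^ 'n" and v :: 'n
  show "half_diameter P {v} = 0" by (simp add: half_diameter_def)
next
  fix P :: "real ^ 'd ^ 'n" and \<sigma> :: "'n set" assume P: "P \<in> point_clouds" and "card \<sigma> = 2"
  then obtain i j where ij: "i \<in> \<sigma>" "j \<in> \<sigma>" "i \<noteq> j" by (auto simp: card_2_iff)
  then have "0 < norm (P $ i - P $ j) / 2" using P by (simp add: point_clouds_def)
  also have "\<dots> \<le> half_diameter P \<sigma>"
    unfolding half_diameter_def using ij by (intro Max_ge) force+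
  finally show "0 < half_diameter P \<sigma>" .
next
  fix P :: "real ^ 'd ^ 'n" and \<sigma> :: "'n set" assume "\<sigma> \<noteq> {}"
  then have "half_diameter P \<sigma> \<in> (\<lambda>(i, j). norm (P $ i - P $ j) / 2) ` (\<sigma> \<times> \<sigma>)"
    unfolding half_diameter_def by (intro Max_in) auto
  then obtain i j where max: "half_diameter P \<sigma> = norm (P $ i - P $ j) / 2" by auto
  have "(half_diameter P \<sigma>)\<^sup>2 = (P $ i - P $ j) \<bullet> (P $ i - P $ j) / 4"
    unfolding max by (simp add: power_divide power2_norm_eq_inner)
  then show "\<exists>h\<in>range (\<lambda>(i, j). (\<lambda>P. (P $ i - P $ j) \<bullet> (P $ i - P $ j) / 4, \<lambda>_. 1)).
      snd h P \<noteq> 0 \<and> (half_diameter P \<sigma>)\<^sup>2 = ratio h P"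
    by (intro bexI[of _ "(\<lambda>P. (P $ i - P $ j) \<bullet> (P $ i - P $ j) / 4, \<lambda>_. 1)"]) auto
qed

lemma vietoris_rips_eq_sublevel: "vietoris_rips P = sublevel_filtration (half_diameter P)"
proof (rule ext, rule set_eqI)
  fix r \<sigma>
  have "half_diameter P \<sigma> \<le> r \<longleftrightarrow> (\<forall>i\<in>\<sigma>. \<forall>j\<in>\<sigma>. norm (P $ i - P $ j) \<le> 2 * r)" if "\<sigma> \<noteq> {}"
    unfolding half_diameter_def using that by (subst Max_le_iff) (auto simp: mult.commute)
  then show "\<sigma> \<in> vietoris_rips P r \<longleftrightarrow> \<sigma> \<in> sublevel_filtration (half_diameter P) r"
    by (auto simp: vietoris_rips_def sublevel_filtration_def)
qed


definition cech_radius :: "real ^ 'd ^ 'n \<Rightarrow> 'n set \<Rightarrow> real" where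
  "cech_radius P \<sigma> = min_enclosing_radius (\<lambda>i. P $ i) \<sigma>"

lemma cech_eq_sublevel: "cech P = sublevel_filtration (cech_radius P)"
proof (rule ext, rule set_eqI)
  fix r \<sigma>
  have "cech_radius P \<sigma> \<le> r \<longleftrightarrow> (\<exists>q. \<forall>i\<in>\<sigma>. norm (P $ i - q) \<le> r)" if "\<sigma> \<noteq> {}"
    unfolding cech_radius_def enclosing_radii_eq[OF finite_class.finite that, symmetric]
    by (simp add: enclosing_radii_def)
  then show "\<sigma> \<in> cech P r \<longleftrightarrow> \<sigma> \<in> sublevel_filtration (cech_radius P) r"
    by (auto simp: cech_def sublevel_filtration_def)
qed

lemma rational_radius_cech:
  "\<exists>H. rational_radius (cech_radius :: real ^ 'd ^ 'n \<Rightarrow> 'n set \<Rightarrow> real) H"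
proof -
  define h where "h v K = (SOME h :: (real ^ 'd ^ 'n \<Rightarrow> real) \<times> (real ^ 'd ^ 'n \<Rightarrow> real).
      computes_circumradius v K h)" for v K
  have h: "computes_circumradius v K (h v K)" for v K
    unfolding h_def by (rule someI_ex[OF circumradius_rational])
  define H where "H = range (\<lambda>(v, K). h v K)"
  have fin: "finite \<sigma>" for \<sigma> :: "'n set" by simp
  have nonneg: "0 \<le> cech_radius P \<sigma>" if "\<sigma> \<noteq> {}" for P :: "real ^ 'd ^ 'n" and \<sigma>
    unfolding cech_radius_def
    using enclosing_radii_nonneg[OF that min_enclosing_radius_attained[OF fin that]] .
  have "rational_radius (cech_radius :: real ^ 'd ^ 'n \<Rightarrow> 'n set \<Rightarrow> real) H"
    unfolding rational_radius_def
  proof (intro conjI allI ballI impI)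
    show "finite H" by (simp add: H_def)
    show "real_polynomial_function (fst f)" "real_polynomial_function (snd f)" if "f \<in> H" for f
      using that h by (auto simp: H_def computes_circumradius_def)
  next
    fix \<sigma> :: "'n set" assume \<sigma>: "\<sigma> \<noteq> {}"
    have lipschitz: "cech_radius Q \<sigma> \<le> cech_radius P \<sigma> + dist P Q" for P Q :: "real ^ 'd ^ 'n"
      unfolding cech_radius_def
    proof (rule min_enclosing_radius_lipschitz[OF fin \<sigma>])
      fix i
      show "norm (P $ i - Q $ i) \<le> dist P Q"
        using Finite_Cartesian_Product.norm_nth_le[of "P - Q" i] by (simp add: dist_norm)
    qed
    have "dist (cech_radius Q \<sigma>) (cech_radius P \<sigma>) \<le> dist Q P" for P Q :: "real ^ 'd ^ 'n"
      using lipschitz[of P Q] lipschitz[of Q P] by (simp add: dist_real_def abs_le_iff dist_commute)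
    then show "continuous_on UNIV (\<lambda>P::real ^ 'd ^ 'n. cech_radius P \<sigma>)"
      unfolding continuous_on_iff by (meson le_less_trans)
  next
    fix P :: "real ^ 'd ^ 'n" and \<sigma> :: "'n set" assume "\<sigma> \<noteq> {}"
    then show "0 \<le> cech_radius P \<sigma>" by (rule nonneg)
  next
    fix P :: "real ^ 'd ^ 'n" and v :: 'n
    have "0 \<in> enclosing_radii (\<lambda>i. P $ i) {v}" by (auto simp: enclosing_radii_def)
    then have "cech_radius P {v} \<le> 0" by (simp add: enclosing_radii_eq cech_radius_def)
    with nonneg[of "{v}" P] show "cech_radius P {v} = 0" by simp
  next
    fix P :: "real ^ 'd ^ 'n" and \<sigma> :: "'n set" assume P: "P \<in> point_clouds" and "card \<sigma> = 2"
    then obtain i j where ij: "i \<in> \<sigma>" "j \<in> \<sigma>" "i \<noteq> j" by (auto simp: card_2_iff)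
    then have "\<sigma> \<noteq> {}" by blast
    have "cech_radius P \<sigma> \<noteq> 0"
    proof
      assume "cech_radius P \<sigma> = 0"
      then have "0 \<in> enclosing_radii (\<lambda>i. P $ i) \<sigma>"
        using min_enclosing_radius_attained[OF fin \<open>\<sigma> \<noteq> {}\<close>, of "\<lambda>i. P $ i"] by (simp add: cech_radius_def)
      then obtain q where "\<forall>i\<in>\<sigma>. P $ i = q" by (auto simp: enclosing_radii_def)
      then have "P $ i = P $ j" using ij by simp
      then show False using P ij by (simp add: point_clouds_def)
    qed
    with nonneg[OF \<open>\<sigma> \<noteq> {}\<close>, of P] show "0 < cech_radius P \<sigma>" by simp
  next
    fix P :: "real ^ 'd ^ 'n" and \<sigma> :: "'n set" assume P: "P \<in> point_clouds" and \<sigma>: "\<sigma> \<noteq> {}"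
    obtain v K c where "independent_family (\<lambda>j. P $ j - P $ v) K"
      "c - P $ v \<in> span ((\<lambda>j. P $ j - P $ v) ` K)"
      "\<forall>j\<in>K. norm (P $ j - c) = norm (P $ v - c)"
      and r: "norm (P $ v - c) = min_enclosing_radius (\<lambda>i. P $ i) \<sigma>"
      by (rule min_enclosing_radius_is_circumradius[OF P \<sigma>]) (rule that; assumption)
    then have "snd (h v K) P \<noteq> 0 \<and> (cech_radius P \<sigma>)\<^sup>2 = ratio (h v K) P"
      using h[of v K] unfolding computes_circumradius_def cech_radius_def r[symmetric] by simp
    then show "\<exists>h\<in>H. snd h P \<noteq> 0 \<and> (cech_radius P \<sigma>)\<^sup>2 = ratio h P"
      by (auto simp: H_def)
  qed
  then show ?thesis by blast
qed


section \<open>Dimension of the fibers of persistent homology\<close>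

theorem theorem1:
  fixes X :: "real ^ 'd ^ 'n::{finite,linorder} \<Rightarrow> real \<Rightarrow> 'n::{finite,linorder} set set"
  assumes "X = cech \<or> X = vietoris_rips"
  shows "\<exists>A :: (real ^ 'd ^ 'n::{finite,linorder}) set. algebraic_set A \<and> A \<noteq> UNIV \<and>
    (\<forall>P \<in> point_clouds - A. \<forall>D k.
       has_persistent_homology TYPE('f::field) (X P) D \<and> card (bounded_endpoints D) = k \<longrightarrow>
       semialgebraic_dim (ph_fiber TYPE('f) X D)
         \<ge> ereal (real CARD('n) * real CARD('d) - real k + 1))"
proof -
  have dim: ?thesis
    if "rational_radius \<rho> H" and X: "X = (\<lambda>P. sublevel_filtration (\<rho> P))" for \<rho> H
    unfolding X by (rule ph_fiber_dim_generic[OF that(1)])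
  obtain H :: "((real ^ 'd ^ 'n::{finite,linorder} \<Rightarrow> real) \<times> (real ^ 'd ^ 'n::{finite,linorder} \<Rightarrow> real)) set"
    where H: "rational_radius cech_radius H"
    using rational_radius_cech by blast
  from assms show ?thesis
  proof
    assume "X = cech"
    then show ?thesis by (intro dim[OF H] ext) (simp add: cech_eq_sublevel)
  next
    assume "X = vietoris_rips"
    then show ?thesis
      by (intro dim[OF rational_radius_half_diameter] ext) (simp add: vietoris_rips_eq_sublevel)
  qed
qed

end
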